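(* Let $S$ be a locally compact Hausdorff space, let $n$ be a positive integer, and let $X=(X_1,\ldots,X_n)$ be an exchangeable random element of $S^n$ such that the law of $X_1$ is outer regular and tight; assume moreover that the $\sigma$-algebra $\mathscr{S}$ on $S$ is the Baire $\sigma$-algebra. Then the following are equivalent: (1) $X$ is $N$-extendible for all $N\ge n$; (2) $\|\mathcal T\|=1$, where $\|\mathcal T\|:=\sup\{|\mathbb{E}\, g(X_1,\ldots,X_n)| : g:S^n\to\mathbb{R}\text{ bounded measurable},\ |I(g,\pi)|\le 1 \text{ for all } \pi\in\mathscr{P}(S)\}$ and $I(g,\pi):=\int_{S^n} g(x_1,\ldots,x_n)\,\pi(dx_1)\cdots\pi(dx_n)$; (3) there is a probability measure $\nu$ on $\mathscr{P}(S)$ such that $\mathbb{P}((X_1,\ldots,X_n)\in A)=\int_{\mathscr{P}(S)}\pi^n(A)\,\nu(d\pi)$ for all $A\in\mathscr{S}^n$.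
   Context: The Baire $\sigma$-algebra of $S$ is the $\sigma$-algebra generated by the continuous functions $S\to\mathbb{R}$ with compact support. $S^n$ carries the product $\sigma$-algebra $\mathscr{S}^n$; $\mathscr{P}(S)$ is the set of probability measures on $(S,\mathscr{S})$ with the smallest $\sigma$-algebra making $\pi\mapsto\pi(B)$ measurable for all $B\in\mathscr{S}$; $\pi^n$ is the $n$-fold product measure. A random element of $S^n$ is exchangeable if its law is invariant under all permutations of coordinates; for $N\ge n$, $X$ is $N$-extendible if there is an exchangeable random element $(Y_1,\ldots,Y_N)$ of $S^N$ with $(Y_1,\ldots,Y_n)$ equal in distribution to $X$. A probability measure $P$ on $S$ is tight if for every $\epsilon>0$ there is compact $K$ with $P(K)\ge 1-\epsilon$, and outer regular if $P(A)=\inf\{P(O):O\supset A\text{ open}\}$. *)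

theory Defs
  imports "HOL-Probability.Probability"
begin

definition Baire :: "'a::topological_space measure" where
  "Baire = sigma UNIV
     (\<Union>f\<in>{f :: 'a \<Rightarrow> real. continuous_on UNIV f \<and> compact (closure {x. f x \<noteq> 0})}.
        {f -` B | B. B \<in> sets borel})"

definition prodS :: "nat \<Rightarrow> 'a::topological_space measure \<Rightarrow> (nat \<Rightarrow> 'a) measure" where
  "prodS n K = PiM {..<n} (\<lambda>_. K)"

definition exchangeable_law :: "nat \<Rightarrow> (nat \<Rightarrow> 'a::topological_space) measure \<Rightarrow> bool" where
  "exchangeable_law n Q \<longleftrightarrow> prob_space Q \<and> sets Q = sets (prodS n (Baire :: 'a measure)) \<and>
     (\<forall>\<sigma>. \<sigma> permutes {..<n} \<longrightarrow>
        distr Q (prodS n Baire) (\<lambda>x. \<lambda>i\<in>{..<n}. x (\<sigma> i)) = Q)"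

definition extendible_law :: "nat \<Rightarrow> nat \<Rightarrow> (nat \<Rightarrow> 'a::topological_space) measure \<Rightarrow> bool" where
  "extendible_law n N P \<longleftrightarrow> (\<exists>Q. exchangeable_law N Q \<and>
     distr Q (prodS n Baire) (\<lambda>y. restrict y {..<n}) = P)"

definition outer_regular :: "'a::topological_space measure \<Rightarrow> bool" where
  "outer_regular P \<longleftrightarrow> (\<forall>A\<in>sets P. measure P A = (INF U\<in>{U. open U \<and> U \<in> sets P \<and> A \<subseteq> U}. measure P U))"

definition tight_measure :: "'a::topological_space measure \<Rightarrow> bool" where
  "tight_measure P \<longleftrightarrow> (\<forall>e>0. \<exists>K. compact K \<and> K \<in> sets P \<and> measure P K \<ge> 1 - e)"

definition Iprod :: "nat \<Rightarrow> ((nat \<Rightarrow> 'a) \<Rightarrow> real) \<Rightarrow> 'a measure \<Rightarrow> real" where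
  "Iprod n g \<pi> = integral\<^sup>L (PiM {..<n} (\<lambda>_. \<pi>)) g"

definition normT :: "nat \<Rightarrow> (nat \<Rightarrow> 'a::topological_space) measure \<Rightarrow> ereal" where
  "normT n P = (SUP g\<in>{g. g \<in> borel_measurable (prodS n (Baire :: 'a measure)) \<and>
                       (\<exists>B. \<forall>x. \<bar>g x\<bar> \<le> B) \<and>
                       (\<forall>\<pi>\<in>space (prob_algebra (Baire :: 'a measure)). \<bar>Iprod n g \<pi>\<bar> \<le> 1)}.
                  ereal \<bar>integral\<^sup>L P g\<bar>)"

end

theory Submission
  imports Defs
begin

text \<open>
  (3) implies (1) by mixing the product measures \<open>\<pi>\<^sup>N\<close>. (1) implies (2) because, for the empirical measure
  \<open>\<pi>\<close> of an exchangeable extension \<open>Y\<^sub>1, \<dots>, Y\<^sub>N\<close>, the integral \<open>I(g, \<pi>)\<close> averages \<open>g\<close> over all index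
  \<open>n\<close>-tuples, and all but a fraction \<open>O(1/N)\<close> of these are injective.

  For (2) implies (3), \<open>\<parallel>T\<parallel> = 1\<close> makes \<open>I(g, \<cdot>) \<mapsto> E g(X)\<close> a well-defined positive functional, and
  Hahn--Banach extends it to a positive functional \<open>L\<close> on all bounded functions on \<open>P(S)\<close>. Restricted to
  bounded measurable functions that are continuous for the weak topology, \<open>L\<close> is continuous along
  sequences decreasing to \<open>0\<close>: otherwise tightness of the law of \<open>X\<^sub>1\<close> yields a tight sequence of
  measures on which the functions stay bounded away from \<open>0\<close>, and a cluster point of that sequence
  (Tychonoff, Dini and Daniell's theorem on \<open>S\<close>) is a measure at which they do not tend to \<open>0\<close>.
  Daniell's theorem on \<open>P(S)\<close> then represents \<open>L\<close> by the mixing measure \<open>\<nu>\<close>.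
\<close>

section \<open>The Hahn--Banach theorem\<close>

text \<open>\<open>P(S)\<close> is in general not compact, so a positive functional on its
  continuous functions may be only finitely additive; tightness of one marginal law has to supply
  countable additivity. This works because \<open>\<pi>(-K)\<close> equals
  \<open>I(g, \<pi>)\<close> for \<open>g\<close> the indicator of \<open>x_1\<close> lying outside
  \<open>K\<close>, so \<open>L\<close> gives it the value \<open>P(X_1 \<notin> K)\<close>. It is
  bounded but in general not weakly continuous; on all bounded functions \<open>L\<close> can
  nevertheless be applied to an inequality between a continuous function and a sum of such tails.
  The extension \<open>L\<close> need not be unique. What identifies \<open>\<nu>\<close> are its
  values on products \<open>\<pi>(f_1) ... \<pi>(f_n)\<close> with bounded continuous
  \<open>f_i\<close>: they are weakly continuous, so \<open>\<nu>\<close> reproduces them, they have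
  the form \<open>I(g, \<pi>)\<close>, so \<open>L\<close> is prescribed there, and such
  \<open>g\<close> determine the law of \<open>X\<close>. \<open>S\<close> need not be metrizable.
  Hence limits of measures are taken along filters, and the sigma-algebra of \<open>P(S)\<close>,
  generated by evaluations, is recovered from functions that are both measurable and weakly
  continuous.\<close>

definition function_subspace :: "('x \<Rightarrow> real) set \<Rightarrow> bool" where
  "function_subspace V \<longleftrightarrow> V \<noteq> {} \<and> (\<forall>f\<in>V. \<forall>g\<in>V. (\<lambda>x. f x + g x) \<in> V) \<and>
     (\<forall>f\<in>V. \<forall>c. (\<lambda>x. c * f x) \<in> V)"

definition sublinear_on :: "('x \<Rightarrow> real) set \<Rightarrow> (('x \<Rightarrow> real) \<Rightarrow> real) \<Rightarrow> bool" where
  "sublinear_on V p \<longleftrightarrow> (\<forall>f\<in>V. \<forall>g\<in>V. p (\<lambda>x. f x + g x) \<le> p f + p g) \<and>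
     (\<forall>f\<in>V. \<forall>c\<ge>0. p (\<lambda>x. c * f x) \<le> c * p f)"

definition linear_functional_on :: "('x \<Rightarrow> real) set \<Rightarrow> (('x \<Rightarrow> real) \<Rightarrow> real) \<Rightarrow> bool" where
  "linear_functional_on V L \<longleftrightarrow> (\<forall>f\<in>V. \<forall>g\<in>V. L (\<lambda>x. f x + g x) = L f + L g) \<and>
     (\<forall>f\<in>V. \<forall>c. L (\<lambda>x. c * f x) = c * L f)"

lemma function_subspace_add: "function_subspace V \<Longrightarrow> f \<in> V \<Longrightarrow> g \<in> V \<Longrightarrow> (\<lambda>x. f x + g x) \<in> V"
  and function_subspace_scale: "function_subspace V \<Longrightarrow> f \<in> V \<Longrightarrow> (\<lambda>x. c * f x) \<in> V"
  by (auto simp: function_subspace_def)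

lemma function_subspace_uminus: "function_subspace V \<Longrightarrow> f \<in> V \<Longrightarrow> (\<lambda>x. - f x) \<in> V"
  using function_subspace_scale[of V f "-1"] by simp

lemma function_subspace_diff:
  "function_subspace V \<Longrightarrow> f \<in> V \<Longrightarrow> g \<in> V \<Longrightarrow> (\<lambda>x. f x - g x) \<in> V"
  using function_subspace_add[of V f "\<lambda>x. - g x"] function_subspace_uminus[of V g] by simp

lemma function_subspace_zero: "function_subspace V \<Longrightarrow> (\<lambda>x. 0) \<in> V"
  using function_subspace_scale[of V _ 0] by (auto simp: function_subspace_def)

lemma sublinear_on_add: "sublinear_on V p \<Longrightarrow> f \<in> V \<Longrightarrow> g \<in> V \<Longrightarrow> p (\<lambda>x. f x + g x) \<le> p f + p g"
  and sublinear_on_scale: "sublinear_on V p \<Longrightarrow> f \<in> V \<Longrightarrow> 0 \<le> c \<Longrightarrow> p (\<lambda>x. c * f x) \<le> c * p f"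
  by (auto simp: sublinear_on_def)

lemma sublinear_on_zero:
  assumes V: "function_subspace V" and p: "sublinear_on V p"
  shows "p (\<lambda>x. 0) = 0"
  using sublinear_on_add[OF p function_subspace_zero[OF V] function_subspace_zero[OF V]]
    sublinear_on_scale[OF p function_subspace_zero[OF V], of 0] by simp

lemma sublinear_on_scale_eq:
  assumes V: "function_subspace V" and p: "sublinear_on V p" and f: "f \<in> V" and c: "0 \<le> c"
  shows "p (\<lambda>x. c * f x) = c * p f"
proof (cases "c = 0")
  case True
  then show ?thesis using sublinear_on_zero[OF V p] by simp
next
  case False
  then have "0 < c" using c by simp
  have "p (\<lambda>x. (1/c) * (c * f x)) \<le> (1/c) * p (\<lambda>x. c * f x)"
    using \<open>0 < c\<close> by (intro sublinear_on_scale[OF p] function_subspace_scale[OF V f]) auto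
  then have "c * p f \<le> p (\<lambda>x. c * f x)"
    using \<open>0 < c\<close> by (simp add: field_simps)
  then show ?thesis using sublinear_on_scale[OF p f c] by linarith
qed

lemma sublinear_on_lower:
  assumes V: "function_subspace V" and p: "sublinear_on V p" and f: "f \<in> V" and g: "g \<in> V"
  shows "- p (\<lambda>x. - f x) \<le> p f" "p g - p (\<lambda>x. - f x) \<le> p (\<lambda>x. f x + g x)"
proof -
  have m: "(\<lambda>x. - f x) \<in> V" by (rule function_subspace_uminus[OF V f])
  show "- p (\<lambda>x. - f x) \<le> p f"
    using sublinear_on_add[OF p f m] sublinear_on_zero[OF V p] by simp
  show "p g - p (\<lambda>x. - f x) \<le> p (\<lambda>x. f x + g x)"
    using sublinear_on_add[OF p function_subspace_add[OF V f g] m] by simp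
qed

text \<open>If \<open>q\<close> is a minimal sublinear functional, then for fixed \<open>y\<close> the sublinear functional
  \<open>x \<mapsto> inf {q (x + t y) - t q y | t \<ge> 0}\<close> lies below \<open>q\<close>, hence equals it,
  and \<open>t = 1\<close> yields superadditivity.\<close>

lemma minimal_sublinear_superadditive:
  assumes V: "function_subspace V" and q: "sublinear_on V q"
    and minimal: "\<And>r. sublinear_on V r \<Longrightarrow> (\<And>f. f \<in> V \<Longrightarrow> r f \<le> q f) \<Longrightarrow> (\<And>f. f \<in> V \<Longrightarrow> r f = q f)"
    and y: "y \<in> V" and z: "z \<in> V"
  shows "q z + q y \<le> q (\<lambda>x. z x + y x)"
proof -
  define r where "r f = (INF t\<in>{0..}. q (\<lambda>x. f x + t * y x) - t * q y)" for f
  \<comment> \<open>Since \<open>q (t * y) = t * q y\<close> for \<open>t \<ge> 0\<close>, this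
    bound is independent of \<open>t\<close>, and the infimum defining \<open>r\<close> is
    finite.\<close>
  have lower: "- q (\<lambda>x. - f x) \<le> q (\<lambda>x. f x + t * y x) - t * q y" if "f \<in> V" "0 \<le> t" for f t
    using sublinear_on_lower(2)[OF V q that(1) function_subspace_scale[OF V y, of t]]
      sublinear_on_scale_eq[OF V q y that(2)] by (simp add: algebra_simps)
  have r_le: "r f \<le> q (\<lambda>x. f x + t * y x) - t * q y" if "f \<in> V" "0 \<le> t" for f t
    unfolding r_def using that lower[OF that(1)]
    by (intro cINF_lower bdd_belowI2[where m="- q (\<lambda>x. - f x)"]) auto
  have le_r: "m \<le> r f" if "\<And>t. 0 \<le> t \<Longrightarrow> m \<le> q (\<lambda>x. f x + t * y x) - t * q y" for f m
    unfolding r_def using that by (intro cINF_greatest) auto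
  have "sublinear_on V r"
    unfolding sublinear_on_def
  proof (intro conjI ballI allI impI)
    fix f g assume fg: "f \<in> V" "g \<in> V"
    have "r (\<lambda>x. f x + g x) - (q (\<lambda>x. f x + t * y x) - t * q y) \<le> q (\<lambda>x. g x + s * y x) - s * q y"
      if "0 \<le> t" "0 \<le> s" for t s
    proof -
      have "r (\<lambda>x. f x + g x) \<le> q (\<lambda>x. (f x + t * y x) + (g x + s * y x)) - (t + s) * q y"
        using r_le[of "\<lambda>x. f x + g x" "t + s"] function_subspace_add[OF V fg] that
        by (simp add: algebra_simps)
      also have "\<dots> \<le> q (\<lambda>x. f x + t * y x) + q (\<lambda>x. g x + s * y x) - (t + s) * q y"
        by (intro diff_right_mono sublinear_on_add[OF q] function_subspace_add[OF V] fg
            function_subspace_scale[OF V y])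
      finally show ?thesis by (simp add: algebra_simps)
    qed
    note * = this
    have **: "r (\<lambda>x. f x + g x) - (q (\<lambda>x. f x + t * y x) - t * q y) \<le> r g" if "0 \<le> t" for t
      by (intro le_r * that)
    have "r (\<lambda>x. f x + g x) - r g \<le> q (\<lambda>x. f x + t * y x) - t * q y" if "0 \<le> t" for t
      using **[OF that] by linarith
    then have "r (\<lambda>x. f x + g x) - r g \<le> r f" by (intro le_r) auto
    then show "r (\<lambda>x. f x + g x) \<le> r f + r g" by simp
  next
    fix f and c :: real assume f: "f \<in> V" and c: "0 \<le> c"
    have cf: "(\<lambda>x. c * f x) \<in> V" by (rule function_subspace_scale[OF V f])
    show "r (\<lambda>x. c * f x) \<le> c * r f"
    proof (cases "c = 0")
      case True
      then show ?thesis
        using r_le[OF cf, of 0] sublinear_on_zero[OF V q] by simp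
    next
      case False
      then have "0 < c" using c by simp
      have "r (\<lambda>x. c * f x) / c \<le> q (\<lambda>x. f x + t * y x) - t * q y" if "0 \<le> t" for t
      proof -
        have "r (\<lambda>x. c * f x) \<le> q (\<lambda>x. c * (f x + t * y x)) - (c * t) * q y"
          using r_le[OF cf, of "c * t"] that c by (simp add: algebra_simps)
        also have "\<dots> \<le> c * q (\<lambda>x. f x + t * y x) - (c * t) * q y"
          by (intro diff_right_mono sublinear_on_scale[OF q] function_subspace_add[OF V] f c
            function_subspace_scale[OF V y])
        also have "\<dots> = c * (q (\<lambda>x. f x + t * y x) - t * q y)" by (simp add: algebra_simps)
        finally show ?thesis using \<open>0 < c\<close> by (simp add: field_simps)
      qed
      then have "r (\<lambda>x. c * f x) / c \<le> r f" by (rule le_r)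
      then show ?thesis using \<open>0 < c\<close> by (simp add: field_simps)
    qed
  qed
  moreover have "r f \<le> q f" if "f \<in> V" for f
    using r_le[OF that, of 0] by simp
  ultimately have "r z = q z" using minimal z by blast
  then show ?thesis using r_le[OF z, of 1] by simp
qed

text \<open>Zorn's lemma gives a minimal sublinear functional below \<open>p\<close>. Minimality
  makes it superadditive, hence additive, and additivity turns homogeneity for
  \<open>c \<ge> 0\<close> into homogeneity for all scalars.\<close>

theorem exists_linear_functional_below_sublinear:
  assumes V: "function_subspace V" and p: "sublinear_on V p"
  shows "\<exists>L. linear_functional_on V L \<and> (\<forall>f\<in>V. L f \<le> p f)"
proof -
  \<comment> \<open>With the value 0 outside \<open>V\<close>, functionals that are comparable on
    \<open>V\<close> are comparable everywhere, so minimality in \<open>A\<close> is minimality on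
    \<open>V\<close>. \<open>P\<close> is the reversed pointwise order: its maximal elements are the
    minimal functionals.\<close>
  define A where "A = {q. sublinear_on V q \<and> (\<forall>f\<in>V. q f \<le> p f) \<and> (\<forall>f. f \<notin> V \<longrightarrow> q f = 0)}"
  define P where "P q r \<longleftrightarrow> (\<forall>f. r f \<le> q f)" for q r :: "('a \<Rightarrow> real) \<Rightarrow> real"
  have restrict: "(\<lambda>f. if f \<in> V then q f else 0) \<in> A"
    if "sublinear_on V q" "\<And>f. f \<in> V \<Longrightarrow> q f \<le> p f" for q
    using that unfolding A_def sublinear_on_def
    by (auto simp: function_subspace_add[OF V] function_subspace_scale[OF V])
  have "\<exists>m\<in>A. \<forall>a\<in>A. P m a \<longrightarrow> a = m"
  proof (rule predicate_Zorn)
    show "partial_order_on A (relation_of P A)"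
    proof (intro partial_order_on_relation_ofI)
      show "P a c" if "P a b" "P b c" for a b c
        using that unfolding P_def by (blast intro: order_trans)
      show "a = b" if "P a b" "P b a" for a b
        using that by (auto simp: P_def fun_eq_iff intro: order_antisym)
    qed (simp add: P_def)
    fix C assume C: "C \<in> Chains (relation_of P A)"
    then have CA: "q \<in> A" if "q \<in> C" for q
      using that by (auto simp: Chains_def relation_of_def)
    have chain: "P q r \<or> P r q" if "q \<in> C" "r \<in> C" for q r
      using that C by (auto simp: Chains_def relation_of_def)
    show "\<exists>u\<in>A. \<forall>a\<in>C. P a u"
    proof (cases "C = {}")
      case True
      then show ?thesis using restrict[OF p] by auto
    next
      case False
      define u where "u f = (INF q\<in>C. q f)" for f
      have lower: "- p (\<lambda>x. - f x) \<le> q f" if "q \<in> C" "f \<in> V" for q f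
      proof -
        have "- q (\<lambda>x. - f x) \<le> q f"
          using CA[OF that(1)] by (intro sublinear_on_lower[OF V _ that(2) that(2)]) (auto simp: A_def)
        moreover have "q (\<lambda>x. - f x) \<le> p (\<lambda>x. - f x)"
          using CA[OF that(1)] function_subspace_uminus[OF V that(2)] by (auto simp: A_def)
        ultimately show ?thesis by linarith
      qed
      have u_le: "u f \<le> q f" if "q \<in> C" "f \<in> V" for q f
        unfolding u_def using that lower
        by (intro cINF_lower bdd_belowI2[where m="- p (\<lambda>x. - f x)"]) auto
      have le_u: "m \<le> u f" if "\<And>q. q \<in> C \<Longrightarrow> m \<le> q f" for f m
        unfolding u_def using that False by (intro cINF_greatest) auto
      have "sublinear_on V u"
        unfolding sublinear_on_def
      proof (intro conjI ballI allI impI)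
        fix f g assume fg: "f \<in> V" "g \<in> V"
        note fgV = function_subspace_add[OF V fg]
        have "u (\<lambda>x. f x + g x) - q f \<le> r g" if qr: "q \<in> C" "r \<in> C" for q r
        proof -
          \<comment> \<open>The smaller of \<open>q\<close> and \<open>r\<close> serves as a common
            lower member of the chain; this is what lets subadditivity survive the infimum.\<close>
          obtain s where s: "s \<in> C" "s f \<le> q f" "s g \<le> r g"
            using chain[OF qr] qr unfolding P_def by blast
          have "u (\<lambda>x. f x + g x) \<le> s (\<lambda>x. f x + g x)" by (rule u_le[OF s(1) fgV])
          also have "\<dots> \<le> s f + s g"
            using CA[OF s(1)] fg by (intro sublinear_on_add) (auto simp: A_def)
          finally show ?thesis using s by linarith
        qed
        then have *: "u (\<lambda>x. f x + g x) - q f \<le> u g" if "q \<in> C" for q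
          using that by (intro le_u) auto
        have "u (\<lambda>x. f x + g x) - u g \<le> q f" if "q \<in> C" for q
          using *[OF that] by linarith
        then have "u (\<lambda>x. f x + g x) - u g \<le> u f" by (intro le_u) auto
        then show "u (\<lambda>x. f x + g x) \<le> u f + u g" by simp
      next
        fix f and c :: real assume f: "f \<in> V" and c: "0 \<le> c"
        have cf: "(\<lambda>x. c * f x) \<in> V" by (rule function_subspace_scale[OF V f])
        have *: "u (\<lambda>x. c * f x) \<le> c * q f" if "q \<in> C" for q
          using u_le[OF that cf] sublinear_on_scale[of V q f c] CA[OF that] f c
          by (auto simp: A_def)
        show "u (\<lambda>x. c * f x) \<le> c * u f"
        proof (cases "c = 0")
          case True
          then show ?thesis using * False by auto
        next
          case False
          then have "0 < c" using c by simp
          then have "u (\<lambda>x. c * f x) / c \<le> u f"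
            using * by (intro le_u) (auto simp: field_simps)
          then show ?thesis using \<open>0 < c\<close> by (simp add: field_simps)
        qed
      qed
      moreover obtain q0 where q0: "q0 \<in> C" using False by auto
      ultimately have "(\<lambda>f. if f \<in> V then u f else 0) \<in> A"
        using order_trans[OF u_le[OF q0]] CA[OF q0] by (intro restrict) (simp_all add: A_def)
      moreover have "P q (\<lambda>f. if f \<in> V then u f else 0)" if "q \<in> C" for q
        using u_le[OF that] CA[OF that] by (auto simp: P_def A_def)
      ultimately show ?thesis by blast
    qed
  qed
  then obtain q where qA: "q \<in> A" and min: "\<And>r. r \<in> A \<Longrightarrow> P q r \<Longrightarrow> r = q" by blast
  have q: "sublinear_on V q" and qp: "\<And>f. f \<in> V \<Longrightarrow> q f \<le> p f" using qA by (auto simp: A_def)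
  have minimal: "r f = q f" if r: "sublinear_on V r" "\<And>f. f \<in> V \<Longrightarrow> r f \<le> q f" and f: "f \<in> V" for r f
  proof -
    have "(\<lambda>f. if f \<in> V then r f else 0) = q"
    proof (rule min)
      show "(\<lambda>f. if f \<in> V then r f else 0) \<in> A"
        using r(1) order_trans[OF r(2) qp] by (rule restrict)
      show "P q (\<lambda>f. if f \<in> V then r f else 0)"
        using r(2) qA by (simp add: P_def A_def)
    qed
    from fun_cong[OF this, of f] show ?thesis using f by simp
  qed
  have add: "q (\<lambda>x. f x + g x) = q f + q g" if "f \<in> V" "g \<in> V" for f g
  proof (rule antisym)
    show "q (\<lambda>x. f x + g x) \<le> q f + q g" by (rule sublinear_on_add[OF q that])
    show "q f + q g \<le> q (\<lambda>x. f x + g x)"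
    proof (rule minimal_sublinear_superadditive[OF V q _ that(2,1)])
      fix r f assume "sublinear_on V r" "\<And>f. f \<in> V \<Longrightarrow> r f \<le> q f" "f \<in> V"
      then show "r f = q f" by (rule minimal)
    qed
  qed
  have "q (\<lambda>x. c * f x) = c * q f" if f: "f \<in> V" for f c
  proof (cases "0 \<le> c")
    case True
    then show ?thesis by (rule sublinear_on_scale_eq[OF V q f])
  next
    case False
    have "q (\<lambda>x. c * f x) + q (\<lambda>x. (- c) * f x) = 0"
      using add[of "\<lambda>x. c * f x" "\<lambda>x. (-c) * f x"] sublinear_on_zero[OF V q]
      by (simp add: function_subspace_scale[OF V f] function_subspace_scale[OF V f, of "-c", simplified])
    moreover have "q (\<lambda>x. (- c) * f x) = - c * q f"
      using False by (intro sublinear_on_scale_eq[OF V q f]) auto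
    ultimately show ?thesis by simp
  qed
  with add qp show ?thesis unfolding linear_functional_on_def by blast
qed

lemma linear_functional_on_add:
    "linear_functional_on V L \<Longrightarrow> f \<in> V \<Longrightarrow> g \<in> V \<Longrightarrow> L (\<lambda>x. f x + g x) = L f + L g"
  and linear_functional_on_scale: "linear_functional_on V L \<Longrightarrow> f \<in> V \<Longrightarrow> L (\<lambda>x. c * f x) = c * L f"
  by (auto simp: linear_functional_on_def)

lemma linear_functional_on_uminus:
  "linear_functional_on V L \<Longrightarrow> f \<in> V \<Longrightarrow> L (\<lambda>x. - f x) = - L f"
  using linear_functional_on_scale[of V L f "-1"] by simp

lemma linear_functional_on_diff:
  assumes "function_subspace V" "linear_functional_on V L" "f \<in> V" "g \<in> V"
  shows "L (\<lambda>x. f x - g x) = L f - L g"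
  using linear_functional_on_add[OF assms(2,3) function_subspace_uminus[OF assms(1,4)]]
    linear_functional_on_uminus[OF assms(2,4)] by simp

lemma function_subspace_sum:
  assumes V: "function_subspace V" and f: "\<And>i. i \<in> I \<Longrightarrow> f i \<in> V"
  shows "(\<lambda>x. \<Sum>i\<in>I. f i x) \<in> V"
  using f
  by (induction I rule: infinite_finite_induct)
    (auto simp: function_subspace_zero[OF V] intro!: function_subspace_add[OF V])

lemma linear_functional_on_sum:
  assumes V: "function_subspace V" and L: "linear_functional_on V L" and f: "\<And>i. i \<in> I \<Longrightarrow> f i \<in> V"
  shows "L (\<lambda>x. \<Sum>i\<in>I. f i x) = (\<Sum>i\<in>I. L (f i))"
proof -
  have 0: "L (\<lambda>x. 0) = 0"
    using linear_functional_on_scale[OF L function_subspace_zero[OF V], of 0] by simp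
  show ?thesis
    using f
  proof (induction I rule: infinite_finite_induct)
    case (insert i I)
    then show ?case
      using linear_functional_on_add[OF L, of "f i" "\<lambda>x. \<Sum>i\<in>I. f i x"] function_subspace_sum[OF V, of I f]
      by simp
  qed (auto simp: 0)
qed

section \<open>Positive functionals on bounded functions\<close>

definition bounded_functions :: "'x set \<Rightarrow> ('x \<Rightarrow> real) set" where
  "bounded_functions X = {f. \<exists>B. \<forall>x\<in>X. \<bar>f x\<bar> \<le> B}"

lemma bounded_functionsI: "(\<And>x. x \<in> X \<Longrightarrow> \<bar>f x\<bar> \<le> B) \<Longrightarrow> f \<in> bounded_functions X"
  by (auto simp: bounded_functions_def)

lemma bounded_functionsE:
  assumes "f \<in> bounded_functions X"
  obtains B where "0 < B" "\<And>x. x \<in> X \<Longrightarrow> \<bar>f x\<bar> \<le> B"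
proof -
  obtain B where "\<forall>x\<in>X. \<bar>f x\<bar> \<le> B" using assms by (auto simp: bounded_functions_def)
  then show thesis by (intro that[of "max 1 B"]) (auto simp: le_max_iff_disj)
qed

lemma function_subspace_bounded_functions: "function_subspace (bounded_functions X)"
  unfolding function_subspace_def
proof (intro conjI ballI allI)
  have "(\<lambda>_. 0) \<in> bounded_functions X" by (rule bounded_functionsI[of _ _ 0]) simp
  then show "bounded_functions X \<noteq> {}" by blast
next
  fix f g assume "f \<in> bounded_functions X" "g \<in> bounded_functions X"
  then obtain B C where "\<And>x. x \<in> X \<Longrightarrow> \<bar>f x\<bar> \<le> B" "\<And>x. x \<in> X \<Longrightarrow> \<bar>g x\<bar> \<le> C"
    by (metis bounded_functionsE)
  then show "(\<lambda>x. f x + g x) \<in> bounded_functions X"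
    by (intro bounded_functionsI[of _ _ "B + C"]) (fastforce intro: order_trans[OF abs_triangle_ineq])
next
  fix f and c :: real assume "f \<in> bounded_functions X"
  then obtain B where "\<And>x. x \<in> X \<Longrightarrow> \<bar>f x\<bar> \<le> B" by (metis bounded_functionsE)
  then show "(\<lambda>x. c * f x) \<in> bounded_functions X"
    by (intro bounded_functionsI[of _ _ "\<bar>c\<bar> * B"]) (simp add: abs_mult mult_left_mono)
qed

lemma bounded_functions_const: "(\<lambda>_. c) \<in> bounded_functions X"
  by (rule bounded_functionsI[of _ _ "\<bar>c\<bar>"]) simp

lemma bounded_functions_max:
  assumes "f \<in> bounded_functions X" "g \<in> bounded_functions X"
  shows "(\<lambda>x. max (f x) (g x)) \<in> bounded_functions X"
proof -
  obtain B C where "\<And>x. x \<in> X \<Longrightarrow> \<bar>f x\<bar> \<le> B" "\<And>x. x \<in> X \<Longrightarrow> \<bar>g x\<bar> \<le> C"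
    using assms by (metis bounded_functionsE)
  then show ?thesis by (intro bounded_functionsI[of _ _ "max B C"]) fastforce
qed

lemma bounded_functions_mult:
  assumes "f \<in> bounded_functions X" "g \<in> bounded_functions X"
  shows "(\<lambda>x. f x * g x) \<in> bounded_functions X"
proof -
  obtain B C where "\<And>x. x \<in> X \<Longrightarrow> \<bar>f x\<bar> \<le> B" "\<And>x. x \<in> X \<Longrightarrow> \<bar>g x\<bar> \<le> C"
    using assms by (metis bounded_functionsE)
  then show ?thesis by (intro bounded_functionsI[of _ _ "B * C"]) (fastforce simp: abs_mult intro: mult_mono')
qed

text \<open>The partial functional is given by its graph \<open>R\<close>. \<open>R_le\<close> makes
  the graph single-valued: two values over one \<open>w\<close> differ by a pair
  \<open>(0, d)\<close>, and both signs of \<open>d\<close> give \<open>d \<le> 0\<close>. In the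
  conclusion, the bound by constants encodes positivity and \<open>L 1 = 1\<close> at once.\<close>

theorem positive_extension:
  fixes R :: "(('x \<Rightarrow> real) \<times> real) set"
  assumes X: "X \<noteq> {}"
    and R_nonempty: "R \<noteq> {}"
    and R_add: "\<And>v w d e. (v, d) \<in> R \<Longrightarrow> (w, e) \<in> R \<Longrightarrow> (\<lambda>x. v x + w x, d + e) \<in> R"
    and R_scale: "\<And>w e c. (w, e) \<in> R \<Longrightarrow> (\<lambda>x. c * w x, c * e) \<in> R"
    and R_le: "\<And>w e c. (w, e) \<in> R \<Longrightarrow> (\<And>x. x \<in> X \<Longrightarrow> w x \<le> c) \<Longrightarrow> e \<le> c"
    and R_bounded: "\<And>w e. (w, e) \<in> R \<Longrightarrow> w \<in> bounded_functions X"
  shows "\<exists>L. linear_functional_on (bounded_functions X) L \<and>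
    (\<forall>f\<in>bounded_functions X. \<forall>c. (\<forall>x\<in>X. f x \<le> c) \<longrightarrow> L f \<le> c) \<and> (\<forall>(w, e)\<in>R. L w = e)"
proof -
  note V = function_subspace_bounded_functions[of X]
  \<comment> \<open>\<open>S f\<close> collects the values of the majorants \<open>w + c\<close> of
    \<open>f\<close>, so that \<open>p f\<close> is the largest value positivity allows. A linear
    \<open>L\<close> below \<open>p\<close> automatically extends \<open>R\<close>:
    \<open>p w \<le> e\<close> for \<open>(w, e)\<close> in \<open>R\<close>, used for
    \<open>w\<close> and \<open>- w\<close>, forces \<open>L w = e\<close>.\<close>
  define S where "S f = {e + c |w e c. (w, e) \<in> R \<and> (\<forall>x\<in>X. f x \<le> w x + c)}" for f
  define p where "p f = Inf (S f)" for f
  obtain w0 e0 where "(w0, e0) \<in> R" using R_nonempty by auto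
  then have R0: "(\<lambda>_. 0, 0) \<in> R" using R_scale[of w0 e0 0] by simp
  have S_lower: "m \<le> s" if "s \<in> S f" "\<And>x. x \<in> X \<Longrightarrow> m \<le> f x" for f s m
  proof -
    obtain w e c where s: "s = e + c" "(w, e) \<in> R" "\<And>x. x \<in> X \<Longrightarrow> f x \<le> w x + c"
      using \<open>s \<in> S f\<close> by (auto simp: S_def)
    have "(-1) * e \<le> c - m"
    proof (rule R_le[OF R_scale[OF s(2)]])
      show "(-1) * w x \<le> c - m" if "x \<in> X" for x
        using s(3)[OF that] \<open>\<And>x. x \<in> X \<Longrightarrow> m \<le> f x\<close>[OF that] by simp
    qed
    then show ?thesis using s(1) by simp
  qed
  have bdd: "bdd_below (S f)" if f: "f \<in> bounded_functions X" for f
  proof -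
    obtain B where "\<And>x. x \<in> X \<Longrightarrow> \<bar>f x\<bar> \<le> B" using f by (metis bounded_functionsE)
    then show ?thesis using S_lower[of _ f "-B"] by (intro bdd_belowI[of _ "-B"]) (fastforce simp: abs_le_iff)
  qed
  have S_I: "e + c \<in> S f" if "(w, e) \<in> R" "\<And>x. x \<in> X \<Longrightarrow> f x \<le> w x + c" for w e c f
    using that unfolding S_def by blast
  have S_const: "c \<in> S f" if "\<And>x. x \<in> X \<Longrightarrow> f x \<le> c" for c f
    using S_I[OF R0, of f c] that by simp
  have S_nonempty: "S f \<noteq> {}" if f: "f \<in> bounded_functions X" for f
  proof -
    obtain B where "\<And>x. x \<in> X \<Longrightarrow> \<bar>f x\<bar> \<le> B" using f by (metis bounded_functionsE)
    then show ?thesis using S_const[of f B] by (fastforce simp: abs_le_iff)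
  qed
  have p_le: "p f \<le> s" if "f \<in> bounded_functions X" "s \<in> S f" for f s
    unfolding p_def using that bdd by (intro cInf_lower) auto
  have le_p: "m \<le> p f" if "f \<in> bounded_functions X" "\<And>s. s \<in> S f \<Longrightarrow> m \<le> s" for f m
    unfolding p_def using that S_nonempty by (intro cInf_greatest) auto
  have "sublinear_on (bounded_functions X) p"
    unfolding sublinear_on_def
  proof (intro conjI ballI allI impI)
    fix f g assume f: "f \<in> bounded_functions X" and g: "g \<in> bounded_functions X"
    have *: "p (\<lambda>x. f x + g x) \<le> s + t" if "s \<in> S f" "t \<in> S g" for s t
    proof -
      obtain v d a where v: "s = d + a" "(v, d) \<in> R" "\<And>x. x \<in> X \<Longrightarrow> f x \<le> v x + a"
        using \<open>s \<in> S f\<close> by (auto simp: S_def)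
      obtain w e b where w: "t = e + b" "(w, e) \<in> R" "\<And>x. x \<in> X \<Longrightarrow> g x \<le> w x + b"
        using \<open>t \<in> S g\<close> by (auto simp: S_def)
      have "(d + e) + (a + b) \<in> S (\<lambda>x. f x + g x)"
        using add_mono[OF v(3) w(3)] by (intro S_I[OF R_add[OF v(2) w(2)]]) (simp add: algebra_simps)
      then show ?thesis
        using p_le[OF function_subspace_add[OF V f g]] v(1) w(1) by (simp add: algebra_simps)
    qed
    have "p (\<lambda>x. f x + g x) - s \<le> p g" if "s \<in> S f" for s
      using *[OF that] by (intro le_p[OF g]) (simp add: diff_le_eq add.commute)
    then have "p (\<lambda>x. f x + g x) - p g \<le> p f"
      by (intro le_p[OF f]) (simp add: diff_le_eq add.commute)
    then show "p (\<lambda>x. f x + g x) \<le> p f + p g" by simp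
  next
    fix f and c :: real assume f: "f \<in> bounded_functions X" and c: "0 \<le> c"
    have cf: "(\<lambda>x. c * f x) \<in> bounded_functions X" by (rule function_subspace_scale[OF V f])
    have *: "p (\<lambda>x. c * f x) \<le> c * s" if "s \<in> S f" for s
    proof -
      obtain w e b where w: "s = e + b" "(w, e) \<in> R" "\<And>x. x \<in> X \<Longrightarrow> f x \<le> w x + b"
        using \<open>s \<in> S f\<close> by (auto simp: S_def)
      have "c * e + c * b \<in> S (\<lambda>x. c * f x)"
        using mult_left_mono[OF w(3) c] by (intro S_I[OF R_scale[OF w(2)]]) (simp add: algebra_simps)
      then show ?thesis using p_le[OF cf] w(1) by (simp add: algebra_simps)
    qed
    show "p (\<lambda>x. c * f x) \<le> c * p f"
    proof (cases "c = 0")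
      case True
      then show ?thesis using p_le[OF cf S_const, of 0] by simp
    next
      case False
      then have "0 < c" using c by simp
      then have "p (\<lambda>x. c * f x) / c \<le> p f"
        using * by (intro le_p[OF f]) (simp add: field_simps)
      then show ?thesis using \<open>0 < c\<close> by (simp add: field_simps)
    qed
  qed
  then obtain L where L: "linear_functional_on (bounded_functions X) L"
    and L_le: "\<And>f. f \<in> bounded_functions X \<Longrightarrow> L f \<le> p f"
    using exists_linear_functional_below_sublinear[OF V] by blast
  have "L w = e" if w: "(w, e) \<in> R" for w e
  proof (rule antisym)
    have le: "L v \<le> d" if "(v, d) \<in> R" for v d
      using order_trans[OF L_le p_le, OF R_bounded[OF that] R_bounded[OF that], of "d + 0"]
        S_I[OF that, of v 0] by simp
    show "L w \<le> e" by (rule le[OF w])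
    show "e \<le> L w"
      using le[OF R_scale[OF w, of "-1"]] linear_functional_on_uminus[OF L R_bounded[OF w]] by simp
  qed
  moreover have "L f \<le> c" if "f \<in> bounded_functions X" "\<And>x. x \<in> X \<Longrightarrow> f x \<le> c" for f c
    using order_trans[OF L_le[OF that(1)] p_le[OF that(1) S_const]] that(2) by blast
  ultimately show ?thesis using L by blast
qed

section \<open>Daniell integrals\<close>

text \<open>Layer-cake decomposition: the \<open>k\<close>-th summand is the part of
  \<open>y\<close> between the heights \<open>k\<close> and \<open>k + 1\<close>.\<close>

lemma sum_clamp_unit_steps:
  fixes y :: real
  assumes "0 \<le> y"
  shows "(\<Sum>k<N. min 1 (max 0 (y - real k))) = min y (real N)"
  using assms by (induction N) auto

text \<open>Counting the integer levels below \<open>y\<close> rounds \<open>y\<close> up by less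
  than one. This error vanishes later on division by \<open>N\<close>.\<close>

lemma sum_indicator_steps_le:
  fixes y :: real
  assumes "0 \<le> y"
  shows "(\<Sum>k<N. if real k < y then 1 else 0 :: real) \<le> min (real N) (y + 1)"
  using assms by (induction N) auto

lemma emeasure_lborel_Ico_ne_top: "emeasure lborel {a..<b::real} \<noteq> \<top>"
  by (cases "a \<le> b") simp_all

text \<open>Functions are total while \<open>X\<close> may be a proper part of the type, as the
  probability measures are among all measures. Bounds, signs and limits are therefore required on
  \<open>X\<close> only, and by positivity \<open>E\<close> depends only on the values on
  \<open>X\<close> (see \<open>cong\<close>).\<close>

locale daniell_integral =
  fixes X :: "'x set" and H :: "('x \<Rightarrow> real) set" and E :: "('x \<Rightarrow> real) \<Rightarrow> real"
  assumes subspace: "function_subspace H"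
    and const_one: "(\<lambda>_. 1) \<in> H"
    and max_closed: "\<And>f g. f \<in> H \<Longrightarrow> g \<in> H \<Longrightarrow> (\<lambda>x. max (f x) (g x)) \<in> H"
    and bounded: "\<And>f. f \<in> H \<Longrightarrow> \<exists>B. \<forall>x\<in>X. \<bar>f x\<bar> \<le> B"
    and linear: "linear_functional_on H E"
    and nonneg: "\<And>f. f \<in> H \<Longrightarrow> (\<And>x. x \<in> X \<Longrightarrow> 0 \<le> f x) \<Longrightarrow> 0 \<le> E f"
    and E_one: "E (\<lambda>_. 1) = 1"
    and continuous_at_zero: "\<And>F. (\<And>k. F k \<in> H) \<Longrightarrow> (\<And>x. x \<in> X \<Longrightarrow> decseq (\<lambda>k. F k x)) \<Longrightarrow>
      (\<And>x. x \<in> X \<Longrightarrow> (\<lambda>k. F k x) \<longlonglongrightarrow> 0) \<Longrightarrow> (\<lambda>k. E (F k)) \<longlonglongrightarrow> 0"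
begin

lemmas add = function_subspace_add[OF subspace]
  and diff = function_subspace_diff[OF subspace]
  and scale = function_subspace_scale[OF subspace]
  and uminus = function_subspace_uminus[OF subspace]
  and zero = function_subspace_zero[OF subspace]
  and sum = function_subspace_sum[OF subspace]

lemmas E_add = linear_functional_on_add[OF linear]
  and E_diff = linear_functional_on_diff[OF subspace linear]
  and E_scale = linear_functional_on_scale[OF linear]
  and E_sum = linear_functional_on_sum[OF subspace linear]

lemma const: "(\<lambda>_. c) \<in> H"
  using scale[OF const_one, of c] by simp

lemma E_const: "E (\<lambda>_. c) = c"
  using E_scale[OF const_one, of c] E_one by simp

lemma min_closed: "f \<in> H \<Longrightarrow> g \<in> H \<Longrightarrow> (\<lambda>x. min (f x) (g x)) \<in> H"
  using uminus[OF max_closed[OF uminus uminus, of f g]] by (simp add: minus_max_eq_min)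

lemma mono: "f \<in> H \<Longrightarrow> g \<in> H \<Longrightarrow> (\<And>x. x \<in> X \<Longrightarrow> f x \<le> g x) \<Longrightarrow> E f \<le> E g"
  using nonneg[OF diff, of g f] E_diff[of g f] by simp

lemma cong: "f \<in> H \<Longrightarrow> g \<in> H \<Longrightarrow> (\<And>x. x \<in> X \<Longrightarrow> f x = g x) \<Longrightarrow> E f = E g"
  by (intro antisym mono) auto

definition G :: "'x set set" where
  "G = {{x\<in>X. 0 < f x} |f. f \<in> H}"

lemma positive_set: "f \<in> H \<Longrightarrow> {x\<in>X. 0 < f x} \<in> sigma_sets X G"
  unfolding G_def by (intro sigma_sets.Basic CollectI exI[of _ f]) simp

text \<open>Stripes between two graphs in \<open>X \<times> [0,1)\<close>. Unlike regions below a
  single graph they form a semiring, because the difference of two stripes is the union of two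
  disjoint, possibly empty stripes. The slice over \<open>x\<close> is a half-open interval whose
  length, as a function of \<open>x\<close>, is again in \<open>H\<close>.\<close>

definition region :: "('x \<Rightarrow> real) \<Rightarrow> ('x \<Rightarrow> real) \<Rightarrow> ('x \<times> real) set" where
  "region f g = {(x, t). x \<in> X \<and> max 0 (f x) \<le> t \<and> t < min 1 (g x)}"

definition regions :: "('x \<times> real) set set" where
  "regions = {region f g |f g. f \<in> H \<and> g \<in> H}"

definition represents :: "('x \<Rightarrow> real) \<Rightarrow> ('x \<times> real) set \<Rightarrow> bool" where
  "represents h a \<longleftrightarrow> h \<in> H \<and> (\<forall>x\<in>X. h x = measure lborel (Pair x -` a))"

text \<open>Two functions representing \<open>a\<close> agree on \<open>X\<close>, so the choice
  does not affect \<open>E\<close>.\<close>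

definition vol :: "('x \<times> real) set \<Rightarrow> ennreal" where
  "vol a = ennreal (E (SOME h. represents h a))"

lemma regionsI: "f \<in> H \<Longrightarrow> g \<in> H \<Longrightarrow> region f g \<in> regions"
  by (auto simp: regions_def)

lemma slice_region:
  "x \<in> X \<Longrightarrow> Pair x -` region f g = {max 0 (f x)..<min 1 (g x)}"
  by (auto simp: region_def)

lemma region_empty: "region (\<lambda>_. 0) (\<lambda>_. 0) = {}"
  by (auto simp: region_def)

lemma represents_region:
  assumes "f \<in> H" "g \<in> H"
  shows "represents (\<lambda>x. max 0 (min 1 (g x) - max 0 (f x))) (region f g)"
proof -
  have "measure lborel {a..<b} = max 0 (b - a)" for a b :: real
    by (cases "a \<le> b") (simp_all add: measure_def)
  then show ?thesis
    unfolding represents_def using assms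
    by (auto simp: slice_region intro!: max_closed min_closed diff const)
qed

lemma represents_regions: "a \<in> regions \<Longrightarrow> \<exists>h. represents h a"
  using represents_region unfolding regions_def by blast

lemma vol_eq:
  assumes "represents h a"
  shows "vol a = ennreal (E h)"
proof -
  have "represents (SOME h. represents h a) a"
    using assms by (rule someI[where P="\<lambda>h. represents h a"])
  then have "E (SOME h. represents h a) = E h"
    using assms by (intro cong) (auto simp: represents_def)
  then show ?thesis by (simp add: vol_def)
qed

lemma E_represents_nonneg: "represents h a \<Longrightarrow> 0 \<le> E h"
  by (rule nonneg) (auto simp: represents_def)

lemma semiring_regions: "semiring_of_sets (X \<times> {0..<1}) regions"
proof
  show "regions \<subseteq> Pow (X \<times> {0..<1})"
    by (auto simp: regions_def region_def)
  show "{} \<in> regions" using regionsI[OF const const] region_empty by metis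
next
  fix a b assume "a \<in> regions" "b \<in> regions"
  then obtain f g f' g' where H: "f \<in> H" "g \<in> H" "f' \<in> H" "g' \<in> H"
    and ab: "a = region f g" "b = region f' g'" by (auto simp: regions_def)
  have "a \<inter> b = region (\<lambda>x. max (f x) (f' x)) (\<lambda>x. min (g x) (g' x))"
    unfolding ab region_def by auto
  then show "a \<inter> b \<in> regions" using H by (auto intro!: regionsI max_closed min_closed)
  let ?C = "{region f (\<lambda>x. min (g x) (f' x)), region (\<lambda>x. max (f x) (max (f' x) (g' x))) g}"
  have "?C \<subseteq> regions" using H by (auto intro!: regionsI max_closed min_closed)
  moreover have "disjoint ?C" by (auto simp: disjoint_def region_def)
  moreover have "a - b = \<Union>?C" unfolding ab region_def by auto
  ultimately show "\<exists>C\<subseteq>regions. finite C \<and> disjoint C \<and> a - b = \<Union>C"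
    by (intro exI[of _ ?C]) auto
qed

text \<open>Over each point the slice lengths add up by countable additivity of Lebesgue measure. So
  \<open>h\<close> minus the partial sums decreases to 0 on \<open>X\<close>, and
  \<open>continuous_at_zero\<close> carries the convergence over to \<open>E\<close>.\<close>

lemma countably_additive_vol: "countably_additive regions vol"
proof (rule countably_additiveI)
  fix A :: "nat \<Rightarrow> ('x \<times> real) set"
  assume A: "range A \<subseteq> regions" "disjoint_family A" "\<Union> (range A) \<in> regions"
  obtain h where h: "represents h (\<Union> (range A))" using represents_regions[OF A(3)] by blast
  have "\<exists>h. represents h (A i)" for i using A(1) by (intro represents_regions) auto
  then obtain k where k: "\<And>i. represents (k i) (A i)" by metis
  have hH: "h \<in> H" using h by (simp add: represents_def)
  have kH: "k i \<in> H" for i using k by (simp add: represents_def)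
  have k_sums: "(\<lambda>i. k i x) sums h x" if x: "x \<in> X" for x
  proof -
    have slice_meas: "Pair x -` a \<in> sets lborel \<and> emeasure lborel (Pair x -` a) \<noteq> \<infinity>" if "a \<in> regions" for a
      using that x emeasure_lborel_Ico_ne_top by (auto simp: regions_def slice_region)
    have "(\<lambda>i. measure lborel (Pair x -` A i)) sums measure lborel (\<Union>i. Pair x -` A i)"
    proof (rule measure_UNION)
      show "range (\<lambda>i. Pair x -` A i) \<subseteq> sets lborel" using A(1) slice_meas by fastforce
      show "disjoint_family (\<lambda>i. Pair x -` A i)"
        using A(2) by (auto simp: disjoint_family_on_def)
      show "emeasure lborel (\<Union>i. Pair x -` A i) \<noteq> \<infinity>"
        using slice_meas[OF A(3)] by (simp add: vimage_UN)
    qed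
    then show ?thesis using h k x by (simp add: represents_def vimage_UN)
  qed
  have nn: "0 \<le> k i x" if "x \<in> X" for i x using k[of i] that by (auto simp: represents_def)
  have "(\<lambda>n. E (\<lambda>x. h x - (\<Sum>i<n. k i x))) \<longlonglongrightarrow> 0"
  proof (rule continuous_at_zero)
    show "(\<lambda>x. h x - (\<Sum>i<n. k i x)) \<in> H" for n by (intro diff sum hH kH)
    show "decseq (\<lambda>n. h x - (\<Sum>i<n. k i x))" if "x \<in> X" for x
      using nn[OF that] by (intro decseq_SucI) auto
    show "(\<lambda>n. h x - (\<Sum>i<n. k i x)) \<longlonglongrightarrow> 0" if "x \<in> X" for x
      using tendsto_diff[OF tendsto_const k_sums[OF that, unfolded sums_def], of "h x"] by simp
  qed
  then have "(\<lambda>n. E h - (\<Sum>i<n. E (k i))) \<longlonglongrightarrow> 0"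
    by (simp add: E_diff sum hH kH E_sum)
  then have "(\<lambda>n. E h - (E h - (\<Sum>i<n. E (k i)))) \<longlonglongrightarrow> E h - 0" by (intro tendsto_intros)
  then have "(\<lambda>i. E (k i)) sums E h" by (simp add: sums_def)
  then have "(\<lambda>i. ennreal (E (k i))) sums ennreal (E h)"
    using E_represents_nonneg[OF k] E_represents_nonneg[OF h] by (simp add: sums_ennreal)
  then show "(\<Sum>i. vol (A i)) = vol (\<Union> (range A))"
    by (simp add: vol_eq[OF k] vol_eq[OF h] sums_iff)
qed

text \<open>\<open>\<mu>\<close> is the projection to \<open>X\<close> of the Caratheodory measure
  of the stripes, whose fibres have length one. Only \<open>E f \<le> \<integral> f\<close> for
  \<open>0 \<le> f \<le> 1\<close> needs work, by cutting \<open>f\<close> into thin layers; the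
  reverse inequality is the same statement for \<open>1 - f\<close>, and affine rescaling reaches
  all of \<open>H\<close>.\<close>

theorem representing_measure:
  "\<exists>\<mu>. prob_space \<mu> \<and> space \<mu> = X \<and> sets \<mu> = sigma_sets X G \<and>
     (\<forall>f\<in>H. f \<in> borel_measurable \<mu> \<and> E f = integral\<^sup>L \<mu> f)"
proof -
  interpret semiring_of_sets "X \<times> {0..<1::real}" regions by (rule semiring_regions)
  have "positive regions vol"
    using vol_eq[OF represents_region[OF const const, of 0 0]] E_const[of 0]
    by (simp add: positive_def region_empty)
  then obtain m' where m': "\<And>s. s \<in> regions \<Longrightarrow> m' s = vol s"
    "measure_space (X \<times> {0..<1}) (sigma_sets (X \<times> {0..<1}) regions) m'"
    using caratheodory[OF _ countably_additive_vol] by blast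
  define m where "m = measure_of (X \<times> {0..<1}) regions m'"
  have sets_m: "sets m = sigma_sets (X \<times> {0..<1}) regions" and space_m: "space m = X \<times> {0..<1}"
    using space_closed by (auto simp: m_def)
  have emeasure_m: "emeasure m (region f g) = ennreal (E (\<lambda>x. max 0 (min 1 (g x) - max 0 (f x))))"
    if "f \<in> H" "g \<in> H" for f g
    using that vol_eq[OF represents_region[OF that]] m'(1)[OF regionsI[OF that]] m'(2)
    by (subst emeasure_measure_of[OF m_def]) (auto simp: space_closed regionsI sets_m measure_space_def sigma_sets.Basic)
  define \<mu> where "\<mu> = distr m (sigma X G) fst"
  have GX: "G \<subseteq> Pow X" by (auto simp: G_def)
  have cyl: "fst -` {x\<in>X. 0 < f x} \<inter> space m \<in> sets m" if f: "f \<in> H" for f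
  proof -
    \<comment> \<open>The multiples of \<open>f\<close> exceed every height \<open>t < 1\<close>
      exactly over the points where \<open>f\<close> is positive.\<close>
    have "fst -` {x\<in>X. 0 < f x} \<inter> space m = (\<Union>n. region (\<lambda>_. 0) (\<lambda>x. real n * f x))"
    proof (intro equalityI subsetI)
      fix z assume "z \<in> fst -` {x\<in>X. 0 < f x} \<inter> space m"
      then obtain x t where z: "z = (x, t)" "x \<in> X" "0 < f x" "0 \<le> t" "t < 1" by (auto simp: space_m)
      obtain n where "t < real n * f x" using reals_Archimedean3[OF z(3)] by blast
      then show "z \<in> (\<Union>n. region (\<lambda>_. 0) (\<lambda>x. real n * f x))" using z by (auto simp: region_def)
    next
      fix z assume "z \<in> (\<Union>n. region (\<lambda>_. 0) (\<lambda>x. real n * f x))"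
      then obtain n x t where z: "z = (x, t)" "x \<in> X" "0 \<le> t" "t < 1" "t < real n * f x"
        by (auto simp: region_def)
      then have "0 < real n * f x" by linarith
      then have "0 < f x" by (simp add: zero_less_mult_iff)
      then show "z \<in> fst -` {x\<in>X. 0 < f x} \<inter> space m" using z by (auto simp: space_m)
    qed
    moreover have "region (\<lambda>_. 0) (\<lambda>x. real n * f x) \<in> sets m" for n
      unfolding sets_m using f by (intro sigma_sets.Basic regionsI scale zero)
    ultimately show ?thesis by auto
  qed
  have fst[measurable]: "fst \<in> measurable m (sigma X G)"
  proof (rule measurable_measure_of[OF GX])
    show "fst \<in> space m \<rightarrow> X" by (auto simp: space_m)
    show "fst -` y \<inter> space m \<in> sets m" if "y \<in> G" for y
      using that cyl by (auto simp: G_def)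
  qed
  have "space m = region (\<lambda>_. 0) (\<lambda>_. 1)"
    by (auto simp: space_m region_def)
  then have "emeasure m (space m) = 1"
    using emeasure_m[OF const const, of 0 1] E_const[of 1] by simp
  then interpret m: prob_space m by (rule prob_spaceI)
  interpret \<mu>: prob_space \<mu> unfolding \<mu>_def by (rule m.prob_space_distr) simp
  have space_\<mu>: "space \<mu> = X" and sets_\<mu>: "sets \<mu> = sigma_sets X G"
    using GX by (auto simp: \<mu>_def space_measure_of)
  have meas: "f \<in> borel_measurable \<mu>" if f: "f \<in> H" for f
    unfolding borel_measurable_iff_greater
  proof
    fix a
    have "{w \<in> space \<mu>. a < f w} = {x\<in>X. 0 < f x - a}" by (auto simp: space_\<mu>)
    also have "\<dots> \<in> sets \<mu>" unfolding sets_\<mu>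
      by (rule positive_set[OF diff[OF f const]])
    finally show "{w \<in> space \<mu>. a < f w} \<in> sets \<mu>" .
  qed
  \<comment> \<open>As \<open>f \<le> 1\<close>, \<open>E f\<close> is at most the volume below the
    positive part of \<open>f\<close>, and that stripe lies in the cylinder over
    \<open>{f > 0}\<close>.\<close>
  have E_le_measure: "E f \<le> measure \<mu> {x\<in>X. 0 < f x}" if f: "f \<in> H" "\<And>x. x \<in> X \<Longrightarrow> f x \<le> 1" for f
  proof -
    have "E f \<le> E (\<lambda>x. max 0 (min 1 (f x) - max 0 0))"
      using f by (intro mono max_closed min_closed diff const) auto
    also have "\<dots> = measure m (region (\<lambda>_. 0) f)"
      using f(1) unfolding measure_def
      by (subst emeasure_m)
        (auto intro!: enn2real_ennreal[symmetric] nonneg max_closed min_closed diff const simp del: enn2real_ennreal)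
    also have "\<dots> \<le> measure m (fst -` {x\<in>X. 0 < f x} \<inter> space m)"
      using cyl[OF f(1)] by (intro m.finite_measure_mono) (auto simp: region_def space_m)
    also have "\<dots> = measure \<mu> {x\<in>X. 0 < f x}"
      unfolding \<mu>_def using positive_set[OF f(1)] GX by (intro measure_distr[symmetric]) simp_all
    finally show ?thesis .
  qed
  have integrable: "integrable \<mu> f" if f: "f \<in> H" for f
  proof -
    obtain B where "\<forall>x\<in>X. \<bar>f x\<bar> \<le> B" using bounded[OF f] by blast
    then show ?thesis
      using meas[OF f] by (intro \<mu>.integrable_const_bound[of _ B]) (auto simp: space_\<mu>)
  qed
  have E_le: "E f \<le> integral\<^sup>L \<mu> f" if f: "f \<in> H" "\<And>x. x \<in> X \<Longrightarrow> 0 \<le> f x \<and> f x \<le> 1" for f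
  proof (rule field_le_epsilon)
    fix e :: real assume "0 < e"
    then obtain N :: nat where N: "0 < N" "1 / real N < e"
      using real_arch_inverse[of e] by (auto simp: inverse_eq_divide)
    \<comment> \<open>\<open>g k\<close> is the \<open>k\<close>-th unit layer of
      \<open>N f\<close>. It is at most 1 and positive exactly where \<open>N f > k\<close>, so
      \<open>E_le_measure\<close> bounds \<open>E (g k)\<close> by the measure of that level
      set.\<close>
    define g where "g k x = min 1 (max 0 (real N * f x - real k))" for k x
    have gH: "g k \<in> H" for k
      unfolding g_def using f by (intro min_closed max_closed diff const scale)
    have "real N * E f = E (\<lambda>x. \<Sum>k<N. g k x)"
      unfolding E_scale[OF f(1), symmetric]
    proof (intro cong scale sum f(1) gH)
      fix x assume "x \<in> X"
      then show "real N * f x = (\<Sum>k<N. g k x)"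
        using f(2) by (simp add: g_def sum_clamp_unit_steps mult_left_le)
    qed
    also have "\<dots> = (\<Sum>k<N. E (g k))" by (intro E_sum gH)
    also have "\<dots> \<le> (\<Sum>k<N. measure \<mu> {x\<in>X. 0 < g k x})"
      by (intro sum_mono E_le_measure gH) (auto simp: g_def)
    also have "\<dots> = (\<integral>x. (\<Sum>k<N. indicator {x\<in>X. 0 < g k x} x) \<partial>\<mu>)"
      using positive_set[OF gH]
      by (subst Bochner_Integration.integral_sum)
        (simp_all add: sets_\<mu> space_\<mu> Int_absorb2 subset_iff less_top[symmetric])
    also have "\<dots> \<le> (\<integral>x. real N * f x + 1 \<partial>\<mu>)"
    proof (rule integral_mono)
      show "integrable \<mu> (\<lambda>x. \<Sum>k<N. indicator {x\<in>X. 0 < g k x} x :: real)"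
        using positive_set[OF gH] by (simp add: sets_\<mu> less_top[symmetric])
      show "integrable \<mu> (\<lambda>x. real N * f x + 1)" using integrable[OF f(1)] by simp
      fix x assume x: "x \<in> space \<mu>"
      have "(\<Sum>k<N. indicator {x\<in>X. 0 < g k x} x) = (\<Sum>k<N. if real k < real N * f x then 1 else 0 :: real)"
        using x by (intro sum.cong) (auto simp: g_def space_\<mu> indicator_def)
      also have "\<dots> \<le> real N * f x + 1"
        using sum_indicator_steps_le[of "real N * f x" N] f(2) x by (auto simp: space_\<mu>)
      finally show "(\<Sum>k<N. indicator {x\<in>X. 0 < g k x} x) \<le> real N * f x + 1" .
    qed
    also have "\<dots> = real N * integral\<^sup>L \<mu> f + 1" using integrable[OF f(1)] by (simp add: \<mu>.prob_space)
    finally have "E f \<le> integral\<^sup>L \<mu> f + 1 / real N" using N by (simp add: field_simps)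
    then show "E f \<le> integral\<^sup>L \<mu> f + e" using N by simp
  qed
  have E_eq: "E f = integral\<^sup>L \<mu> f" if f: "f \<in> H" for f
  proof -
    obtain B where B: "\<And>x. x \<in> X \<Longrightarrow> \<bar>f x\<bar> \<le> B" using bounded[OF f] by blast
    obtain x0 where "x0 \<in> X" using \<mu>.not_empty by (auto simp: space_\<mu>)
    then have B0: "0 \<le> B" using B[of x0] by linarith
    \<comment> \<open>\<open>(f + B) / C\<close> takes values in \<open>[0,1]\<close>; the summand 1
      keeps \<open>C\<close> positive when \<open>B = 0\<close>.\<close>
    define C where "C = 2 * B + 1"
    define h where "h x = (1 / C) * (f x + B)" for x
    have C: "0 < C" using B0 by (simp add: C_def)
    have hH: "h \<in> H" unfolding h_def by (intro scale add f const)
    have h01: "0 \<le> h x \<and> h x \<le> 1" if "x \<in> X" for x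
      using B[OF that] C by (auto simp: h_def C_def field_simps abs_le_iff)
    have "E h = integral\<^sup>L \<mu> h"
    proof (rule antisym)
      show "E h \<le> integral\<^sup>L \<mu> h" using hH h01 by (rule E_le)
      have "E (\<lambda>x. 1 - h x) \<le> (\<integral>x. 1 - h x \<partial>\<mu>)" using hH h01 by (intro E_le diff const) auto
      then show "integral\<^sup>L \<mu> h \<le> E h"
        using integrable[OF hH] by (simp add: E_diff const hH E_const \<mu>.prob_space)
    qed
    moreover have "E h = (1 / C) * (E f + B)"
      unfolding h_def by (simp only: E_scale E_add add f const E_const)
    moreover have "integral\<^sup>L \<mu> h = (1 / C) * (integral\<^sup>L \<mu> f + B)"
      unfolding h_def using integrable[OF f] by (simp add: \<mu>.prob_space)
    ultimately show ?thesis using C by simp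
  qed
  show ?thesis
    using \<mu>.prob_space_axioms space_\<mu> sets_\<mu> meas E_eq by blast
qed

end

section \<open>Tight sequences of Baire measures\<close>

text \<open>The open sets \<open>{F k < e}\<close> increase with \<open>k\<close>, so the largest
  index in a finite subcover of \<open>K\<close> serves all points at once.\<close>

lemma Dini_compact:
  fixes F :: "nat \<Rightarrow> 'a::topological_space \<Rightarrow> real"
  assumes K: "compact K" and cont: "\<And>k. continuous_on UNIV (F k)"
    and dec: "\<And>x. decseq (\<lambda>k. F k x)" and lim: "\<And>x. (\<lambda>k. F k x) \<longlonglongrightarrow> 0" and e: "0 < e"
  obtains k where "\<And>x. x \<in> K \<Longrightarrow> F k x < e"
proof -
  have "open {x. F k x < e}" for k
    using cont[of k] by (intro open_Collect_less continuous_on_const)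
  moreover have "\<exists>k. F k x < e" for x
    using order_tendstoD(2)[OF lim e, of x] by (auto simp: eventually_sequentially)
  then have "K \<subseteq> (\<Union>k. {x. F k x < e})" by auto
  ultimately obtain T where T: "finite T" "K \<subseteq> (\<Union>k\<in>T. {x. F k x < e})"
    by (rule compactE_image[OF K])
  show thesis
  proof (rule that)
    fix x assume "x \<in> K"
    then obtain k where k: "k \<in> T" "F k x < e" using T by auto
    have "F (Max T) x \<le> F k x"
      using T(1) k(1) by (intro decseqD[OF dec]) simp
    then show "F (Max T) x < e" using k by simp
  qed
qed

text \<open>Compact support would exclude the constants on a noncompact space, and Daniell's theorem
  needs them. Baire measurability is listed separately because a continuous function without compact
  support need not have it.\<close>

definition test_functions :: "('a::topological_space \<Rightarrow> real) set" where
  "test_functions = {f \<in> borel_measurable Baire. continuous_on UNIV f} \<inter> bounded_functions UNIV"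

lemma test_functionsD:
  assumes "f \<in> test_functions"
  shows "f \<in> borel_measurable Baire" "continuous_on UNIV f" "f \<in> bounded_functions UNIV"
  using assms by (auto simp: test_functions_def)

lemma test_functions_bounded: "f \<in> test_functions \<Longrightarrow> \<exists>B. \<forall>x. \<bar>f x\<bar> \<le> B"
  by (auto simp: test_functions_def bounded_functions_def)

lemma function_subspace_test_functions: "function_subspace (test_functions :: ('a::topological_space \<Rightarrow> real) set)"
  unfolding function_subspace_def
proof (intro conjI ballI allI)
  have "(\<lambda>_. 0) \<in> (test_functions :: ('a \<Rightarrow> real) set)"
    by (auto simp: test_functions_def function_subspace_zero[OF function_subspace_bounded_functions])
  then show "(test_functions :: ('a \<Rightarrow> real) set) \<noteq> {}" by blast
qed (auto simp: test_functions_def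
    function_subspace_add[OF function_subspace_bounded_functions]
    function_subspace_scale[OF function_subspace_bounded_functions] intro!: continuous_intros)

lemma test_functions_max:
  "f \<in> test_functions \<Longrightarrow> g \<in> test_functions \<Longrightarrow> (\<lambda>x. max (f x) (g x)) \<in> test_functions"
  by (auto simp: test_functions_def bounded_functions_max intro!: continuous_intros)

lemma test_functions_const: "(\<lambda>_. c) \<in> test_functions"
  by (auto simp: test_functions_def bounded_functions_const)

lemma test_functions_min:
  assumes "f \<in> test_functions" "g \<in> test_functions"
  shows "(\<lambda>x. min (f x) (g x)) \<in> test_functions"
proof -
  note uminus = function_subspace_uminus[OF function_subspace_test_functions]
  show ?thesis
    using uminus[OF test_functions_max[OF uminus[OF assms(1)] uminus[OF assms(2)]]]
    by (simp add: minus_max_eq_min)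
qed

definition cozero_sets :: "'a::topological_space set set" where
  "cozero_sets = {{x. 0 < f x} |f. f \<in> test_functions}"

lemma space_Baire [simp]: "space Baire = UNIV"
  by (simp add: Baire_def space_measure_of_conv)

text \<open>The Daniell construction ends in the sigma-algebra of cozero sets, which is thereby the
  Baire one. A compactly supported continuous \<open>f\<close> is a test function, since its range
  on the compact closure of \<open>{f \<noteq> 0}\<close> is bounded, and \<open>{f > a}\<close> is
  the cozero set of \<open>f - a\<close>.\<close>

lemma sets_Baire: "sets (Baire :: 'a::topological_space measure) = sigma_sets UNIV cozero_sets"
proof
  let ?C = "{f :: 'a \<Rightarrow> real. continuous_on UNIV f \<and> compact (closure {x. f x \<noteq> 0})}"
  have sets_Baire_eq: "sets Baire = sigma_sets UNIV (\<Union>f\<in>?C. {f -` B | B. B \<in> sets borel})"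
    unfolding Baire_def by (rule sets_measure_of) simp
  show "sigma_sets UNIV cozero_sets \<subseteq> sets (Baire :: 'a measure)"
  proof (rule sets.sigma_sets_subset[of _ Baire, simplified])
    have "{x \<in> space Baire. 0 < f x} \<in> sets Baire" if "f \<in> test_functions" for f :: "'a \<Rightarrow> real"
      using test_functionsD(1)[OF that] by measurable
    then show "cozero_sets \<subseteq> sets (Baire :: 'a measure)" by (auto simp: cozero_sets_def)
  qed
  have C: "f \<in> test_functions" if f: "f \<in> ?C" for f
  proof -
    have "f -` B \<inter> space Baire \<in> sets Baire" if "B \<in> sets borel" for B
      unfolding sets_Baire_eq using f that by (auto intro!: sigma_sets.Basic)
    then have meas: "f \<in> borel_measurable Baire" by (intro measurableI) auto
    have "compact (f ` closure {x. f x \<noteq> 0})"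
      using f by (intro compact_continuous_image) (auto intro: continuous_on_subset)
    then have "bounded (f ` closure {x. f x \<noteq> 0})" by (rule compact_imp_bounded)
    then obtain B where "\<And>x. x \<in> closure {x. f x \<noteq> 0} \<Longrightarrow> \<bar>f x\<bar> \<le> B"
      by (auto simp: bounded_iff)
    then have "\<bar>f x\<bar> \<le> max 0 B" for x
      using closure_subset[of "{x. f x \<noteq> 0}"] by (cases "f x = 0") (auto simp: le_max_iff_disj)
    then show ?thesis
      using f meas by (auto simp: test_functions_def intro: bounded_functionsI)
  qed
  have "f -` B \<in> sigma_sets UNIV cozero_sets" if f: "f \<in> ?C" and B: "B \<in> sets borel" for f B
  proof -
    have "f \<in> borel_measurable (sigma UNIV cozero_sets)"
      unfolding borel_measurable_iff_greater
    proof
      fix a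
      have "{w \<in> space (sigma UNIV cozero_sets). a < f w} = {x. 0 < f x - a}"
        by (auto simp: space_measure_of_conv)
      also have "\<dots> \<in> cozero_sets"
        unfolding cozero_sets_def
        using function_subspace_diff[OF function_subspace_test_functions C[OF f] test_functions_const[of a]]
        by (intro CollectI exI[of _ "\<lambda>x. f x - a"]) simp
      finally show "{w \<in> space (sigma UNIV cozero_sets). a < f w} \<in> sets (sigma UNIV cozero_sets)"
        by (simp add: sigma_sets.Basic)
    qed
    from measurable_sets[OF this B] show ?thesis by (simp add: space_measure_of_conv)
  qed
  then show "sets (Baire :: 'a measure) \<subseteq> sigma_sets UNIV cozero_sets"
    unfolding sets_Baire_eq by (intro sigma_sets_mono) auto
qed

lemma Int_stable_cozero_sets: "Int_stable cozero_sets"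
proof (rule Int_stableI)
  fix A B :: "'a set" assume "A \<in> cozero_sets" "B \<in> cozero_sets"
  then obtain f g where "f \<in> test_functions" "g \<in> test_functions" "A = {x. 0 < f x}" "B = {x. 0 < g x}"
    by (auto simp: cozero_sets_def)
  moreover from this have "A \<inter> B = {x. 0 < min (f x) (g x)}" by auto
  ultimately show "A \<inter> B \<in> cozero_sets"
    unfolding cozero_sets_def
    by (intro CollectI exI[of _ "\<lambda>x. min (f x) (g x)"]) (simp add: test_functions_min)
qed

section \<open>Integrals of test functions against Baire probability measures\<close>

abbreviation PBaire :: "'a::topological_space measure set" where
  "PBaire \<equiv> space (prob_algebra Baire)"

lemma PBaire_iff: "\<pi> \<in> PBaire \<longleftrightarrow> prob_space \<pi> \<and> sets \<pi> = sets Baire"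
  by (auto simp: space_prob_algebra)

lemma PBaire_space: "\<pi> \<in> PBaire \<Longrightarrow> space \<pi> = UNIV"
  using sets_eq_imp_space_eq[of \<pi> Baire] by (auto simp: PBaire_iff)

lemma measurable_PBaire: "\<pi> \<in> PBaire \<Longrightarrow> f \<in> borel_measurable Baire \<Longrightarrow> f \<in> borel_measurable \<pi>"
  using measurable_cong_sets[of \<pi> Baire borel borel] by (auto simp: PBaire_iff)

lemma integrable_test_function:
  assumes "\<pi> \<in> PBaire" "f \<in> test_functions"
  shows "integrable \<pi> f"
proof -
  interpret prob_space \<pi> using assms by (simp add: PBaire_iff)
  obtain B where "\<And>x. \<bar>f x\<bar> \<le> B" using test_functions_bounded[OF assms(2)] by blast
  then show ?thesis
    using measurable_PBaire[OF assms(1) test_functionsD(1)[OF assms(2)]]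
    by (intro integrable_const_bound[of _ B]) auto
qed

text \<open>A non-integrable \<open>f\<close> has integral 0 by convention, and then the bound
  reduces to \<open>0 \<le> B\<close>, which holds because a probability space is nonempty.\<close>

lemma abs_integral_le_bound:
  assumes \<pi>: "prob_space \<pi>" and f: "\<And>x. x \<in> space \<pi> \<Longrightarrow> \<bar>f x\<bar> \<le> (B::real)"
  shows "\<bar>integral\<^sup>L \<pi> f\<bar> \<le> B"
proof (cases "integrable \<pi> f")
  case True
  interpret prob_space \<pi> by fact
  have "f x \<le> B" "- B \<le> f x" if "x \<in> space \<pi>" for x using f[OF that] by auto
  then show ?thesis
    using integral_le_const[OF True, of B] integral_ge_const[OF True, of "-B"] by (simp add: abs_le_iff AE_I2)
next
  case False
  interpret prob_space \<pi> by fact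
  obtain x where "x \<in> space \<pi>" using not_empty by auto
  then show ?thesis using f[of x] False by (simp add: not_integrable_integral_eq)
qed

lemma prob_integral_mono_tail:
  assumes \<pi>: "\<pi> \<in> PBaire" and f: "f \<in> test_functions" and K: "K \<in> sets Baire"
    and fK: "\<And>x. x \<in> K \<Longrightarrow> f x \<le> e" and fB: "\<And>x. f x \<le> B" and nn: "0 \<le> e" "0 \<le> B"
  shows "integral\<^sup>L \<pi> f \<le> e + B * measure \<pi> (- K)"
proof -
  interpret prob_space \<pi> using \<pi> by (simp add: PBaire_iff)
  have K': "- K \<in> sets \<pi>" using K \<pi> sets.compl_sets[OF K] by (simp add: PBaire_iff Compl_eq_Diff_UNIV)
  have "integral\<^sup>L \<pi> f \<le> (\<integral>x. e + B * indicator (- K) x \<partial>\<pi>)"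
  proof (rule integral_mono[OF integrable_test_function[OF \<pi> f]])
    show "integrable \<pi> (\<lambda>x. e + B * indicator (- K) x)"
      using K' by (simp add: less_top[symmetric])
    show "f x \<le> e + B * indicator (- K) x" for x
      using fK[of x] fB[of x] nn by (auto simp: indicator_def)
  qed
  also have "\<dots> = e + B * measure \<pi> (- K)"
    using K' prob_space by (simp add: PBaire_space[OF \<pi>] less_top[symmetric])
  finally show ?thesis .
qed

lemma compact_sequence_cluster_point:
  assumes "compact U" "\<And>j :: nat. x j \<in> U"
  obtains F l where "F \<le> sequentially" "F \<noteq> bot" "(x \<longlongrightarrow> l) F"
proof -
  have "filtermap x sequentially \<noteq> bot" "eventually (\<lambda>y. y \<in> U) (filtermap x sequentially)"
    using assms(2) by (simp_all add: filtermap_bot_iff eventually_filtermap)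
  then obtain l where l: "inf (nhds l) (filtermap x sequentially) \<noteq> bot"
    using assms(1) unfolding compact_filter by blast
  \<comment> \<open>The pulled-back neighbourhood filter of \<open>l\<close> makes \<open>x\<close>
    converge, and \<open>sequentially\<close> preserves every eventual statement. The two are
    compatible exactly because \<open>l\<close> is a cluster point.\<close>
  define F where "F = inf sequentially (filtercomap x (nhds l))"
  have "F \<noteq> bot"
  proof
    assume "F = bot"
    then have "eventually (\<lambda>_. False) F" by simp
    then obtain P Q where PQ: "eventually P sequentially" "eventually Q (filtercomap x (nhds l))"
      "\<And>j. P j \<Longrightarrow> Q j \<Longrightarrow> False" unfolding F_def eventually_inf by blast
    obtain R where R: "eventually R (nhds l)" "\<And>j. R (x j) \<Longrightarrow> Q j"
      using PQ(2) by (auto simp: eventually_filtercomap)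
    have "eventually (\<lambda>y. \<not> R y) (filtermap x sequentially)"
      unfolding eventually_filtermap using PQ(1) by eventually_elim (use PQ(3) R(2) in blast)
    then have "eventually (\<lambda>_. False) (inf (nhds l) (filtermap x sequentially))"
      unfolding eventually_inf using R(1) by blast
    then show False using l by (simp add: eventually_False)
  qed
  moreover have "F \<le> sequentially" by (simp add: F_def)
  moreover have "(x \<longlongrightarrow> l) F"
    by (rule filterlim_mono[OF filterlim_filtercomap order_refl]) (simp add: F_def)
  ultimately show thesis using that by blast
qed

text \<open>Filters on the natural numbers take the place of subnets: the space of measures is not
  metrizable, so a convergent subsequence need not exist.\<close>

lemma tight_sequence_cluster_point:
  fixes \<pi> :: "nat \<Rightarrow> 'a::topological_space measure"
  assumes \<pi>: "\<And>j. \<pi> j \<in> PBaire"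
    and K: "\<And>m. compact (K m)" "\<And>m. K m \<in> sets Baire"
    and tight: "\<And>m. eventually (\<lambda>j. measure (\<pi> j) (- K m) \<le> \<delta> m) sequentially"
    and \<delta>: "\<delta> \<longlonglongrightarrow> 0"
  obtains F \<rho> where "F \<le> sequentially" "F \<noteq> bot" "\<rho> \<in> PBaire"
    "\<And>f. f \<in> test_functions \<Longrightarrow> ((\<lambda>j. integral\<^sup>L (\<pi> j) f) \<longlongrightarrow> integral\<^sup>L \<rho> f) F"
proof -
  note T = function_subspace_test_functions
  define x where "x j f = (if f \<in> test_functions then integral\<^sup>L (\<pi> j) f else 0)" for j f
  have "\<exists>B. \<forall>y. \<bar>f y\<bar> \<le> B" if "f \<in> test_functions" for f :: "'a \<Rightarrow> real"
    by (rule test_functions_bounded[OF that])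
  then obtain b where b: "\<And>(f :: 'a \<Rightarrow> real) y. f \<in> test_functions \<Longrightarrow> \<bar>f y\<bar> \<le> b f" by metis
  \<comment> \<open>Tychonoff: a product of compact intervals indexed by all functions, with a
    trivial factor at those that are not test functions. The point \<open>x j\<close> of
    \<open>U\<close> records all integrals of \<open>\<pi> j\<close>.\<close>
  define U where "U = PiE UNIV (\<lambda>f. if f \<in> test_functions then {- b f..b f} else {0})"
  have "compactin (product_topology (\<lambda>_. euclidean) UNIV) U"
    unfolding U_def compactin_PiE by auto
  then have "compact U" by (simp only: euclidean_product_topology compactin_euclidean_iff)
  moreover have "x j \<in> U" for j
  proof -
    have "\<bar>integral\<^sup>L (\<pi> j) f\<bar> \<le> b f" if "f \<in> test_functions" for f
      using \<pi>[of j] b[OF that] by (intro abs_integral_le_bound) (simp_all add: PBaire_iff)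
    then show ?thesis by (auto simp: U_def x_def abs_le_iff minus_le_iff)
  qed
  ultimately obtain F l where F_seq: "F \<le> sequentially" and F: "F \<noteq> bot" and x_lim: "(x \<longlongrightarrow> l) F"
    by (rule compact_sequence_cluster_point)
  have coordinate: "((\<lambda>j. x j f) \<longlongrightarrow> l f) F" for f
    using continuous_on_product_then_coordinatewise[OF continuous_on_id[of UNIV], of f]
    by (intro continuous_on_tendsto_compose[of UNIV "\<lambda>y. y f" x, OF _ x_lim]) auto
  have lim: "((\<lambda>j. integral\<^sup>L (\<pi> j) f) \<longlongrightarrow> l f) F" if "f \<in> test_functions" for f
    using coordinate[of f] that by (simp add: x_def)
  have integrable: "integrable (\<pi> j) f" if "f \<in> test_functions" for j f
    using integrable_test_function[OF \<pi> that] .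
  have prob: "prob_space (\<pi> j)" for j using \<pi>[of j] by (simp add: PBaire_iff)
  interpret daniell_integral UNIV "test_functions :: ('a \<Rightarrow> real) set" l
  proof
    show "linear_functional_on test_functions l"
      unfolding linear_functional_on_def
    proof (intro conjI ballI allI)
      fix f g :: "'a \<Rightarrow> real" assume fg: "f \<in> test_functions" "g \<in> test_functions"
      show "l (\<lambda>x. f x + g x) = l f + l g"
        using lim[OF function_subspace_add[OF T fg]] tendsto_add[OF lim[OF fg(1)] lim[OF fg(2)]]
          integrable fg by (intro tendsto_unique[OF F]) auto
    next
      fix f :: "'a \<Rightarrow> real" and c :: real assume f: "f \<in> test_functions"
      show "l (\<lambda>x. c * f x) = c * l f"
        using lim[OF function_subspace_scale[OF T f]] tendsto_mult[OF tendsto_const lim[OF f], of c]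
        by (intro tendsto_unique[OF F]) auto
    qed
    show "0 \<le> l f" if "f \<in> test_functions" "\<And>x. x \<in> UNIV \<Longrightarrow> 0 \<le> f x" for f
      by (rule tendsto_lowerbound[OF lim[OF that(1)] _ F]) (use that in simp)
    show "l (\<lambda>_. 1) = 1"
      using tendsto_unique[OF F lim[OF test_functions_const[of 1]], of 1]
      by (simp add: prob_space.prob_space[OF prob])
    show "\<exists>B. \<forall>x\<in>UNIV. \<bar>f x\<bar> \<le> B" if "f \<in> test_functions" for f :: "'a \<Rightarrow> real"
      using b[OF that] by blast
    show "(\<lambda>k. l (f k)) \<longlonglongrightarrow> 0"
      if f: "\<And>k. f k \<in> test_functions" and dec: "\<And>x. x \<in> UNIV \<Longrightarrow> decseq (\<lambda>k. f k x)"
        and lim0: "\<And>x. x \<in> UNIV \<Longrightarrow> (\<lambda>k. f k x) \<longlonglongrightarrow> 0" for f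
    proof (rule LIMSEQ_I)
      fix r :: real assume r: "0 < r"
      \<comment> \<open>A bound for \<open>f 0\<close> bounds the whole decreasing sequence from
        above; the maximum with 1 keeps \<open>B\<close> positive.\<close>
      define B where "B = max 1 (b (f 0))"
      have B: "0 < B" by (simp add: B_def)
      have fB: "f k y \<le> B" for k y
        using decseqD[OF dec, of y 0 k] b[OF f, of 0 y] by (auto simp: B_def)
      have f0: "0 \<le> f k y" for k y
        by (rule decseq_ge[OF dec lim0]) simp_all
      have "eventually (\<lambda>m. B * \<delta> m < r / 2) sequentially"
        using tendsto_mult_right_zero[OF \<delta>, of B] r by (intro order_tendstoD(2)[where y=0]) auto
      then obtain m where m: "B * \<delta> m < r / 2" by (auto simp: eventually_sequentially)
      obtain k where k: "\<And>y. y \<in> K m \<Longrightarrow> f k y < r / 2"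
        using Dini_compact[OF K(1)[of m] test_functionsD(2)[OF f] dec[OF UNIV_I] lim0[OF UNIV_I], of "r / 2"] r by auto
      have "\<bar>l (f n)\<bar> < r" if n: "k \<le> n" for n
      proof -
        \<comment> \<open>Neither \<open>k\<close> nor \<open>m\<close> depends on \<open>j\<close>:
          on \<open>K m\<close> the functions are small by Dini, and off \<open>K m\<close> the mass
          is at most \<open>\<delta> m\<close> for all large \<open>j\<close>. Hence the bound
          passes to the limit along \<open>F\<close>.\<close>
        have "eventually (\<lambda>j. integral\<^sup>L (\<pi> j) (f n) \<le> r / 2 + B * \<delta> m) F"
          using filter_leD[OF F_seq tight[of m]]
        proof eventually_elim
          case (elim j)
          have "f n y \<le> r / 2" if "y \<in> K m" for y
            using decseqD[OF dec n, of y] k[OF that] by simp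
          then have "integral\<^sup>L (\<pi> j) (f n) \<le> r / 2 + B * measure (\<pi> j) (- K m)"
            using r B fB by (intro prob_integral_mono_tail[OF \<pi> f K(2)]) auto
          also have "\<dots> \<le> r / 2 + B * \<delta> m" using elim B by simp
          finally show ?case .
        qed
        then have "l (f n) \<le> r / 2 + B * \<delta> m" by (rule tendsto_upperbound[OF lim[OF f] _ F])
        moreover have "0 \<le> l (f n)"
          by (rule tendsto_lowerbound[OF lim[OF f] _ F]) (simp add: f0)
        ultimately show ?thesis using m by simp
      qed
      then show "\<exists>no. \<forall>n\<ge>no. norm (l (f n) - 0) < r" by auto
    qed
  qed (simp_all add: T test_functions_const test_functions_max)
  obtain \<rho> where \<rho>: "prob_space \<rho>" "sets \<rho> = sigma_sets UNIV G"
    "\<And>f. f \<in> test_functions \<Longrightarrow> l f = integral\<^sup>L \<rho> f"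
    using representing_measure by blast
  have "G = cozero_sets" by (simp add: G_def cozero_sets_def)
  then have "\<rho> \<in> PBaire" using \<rho> by (simp add: PBaire_iff sets_Baire)
  then show thesis using that[OF F_seq F] lim \<rho>(3) by simp
qed

section \<open>Representing functionals on the space of probability measures\<close>

text \<open>A ramp that steepens with \<open>k\<close> and approximates the indicator of
  \<open>{f > 0}\<close>; it links measures of cozero sets to integrals of test functions.\<close>

definition cutoff :: "('a \<Rightarrow> real) \<Rightarrow> nat \<Rightarrow> 'a \<Rightarrow> real" where
  "cutoff f k x = min 1 (max 0 (real k * f x))"

lemma cutoff_test_functions: "f \<in> test_functions \<Longrightarrow> cutoff f k \<in> test_functions"
  unfolding cutoff_def
  by (intro test_functions_min test_functions_max test_functions_const
      function_subspace_scale[OF function_subspace_test_functions])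

lemma cutoff_bounds: "0 \<le> cutoff f k x" "cutoff f k x \<le> 1" "\<bar>cutoff f k x\<bar> \<le> 1"
  by (auto simp: cutoff_def)

lemma cutoff_tendsto: "(\<lambda>k. cutoff f k x) \<longlonglongrightarrow> indicator {x. 0 < f x} x"
proof (cases "0 < f x")
  case True
  then obtain n where n: "1 < real n * f x" using reals_Archimedean3 by blast
  have "eventually (\<lambda>k. cutoff f k x = 1) sequentially"
    using eventually_ge_at_top[of n]
  proof eventually_elim
    case (elim k)
    then have "real n * f x \<le> real k * f x" using True by simp
    then show ?case using n by (simp add: cutoff_def)
  qed
  then show ?thesis using True by (simp add: tendsto_eventually)
next
  case False
  then have "cutoff f k x = 0" for k by (simp add: cutoff_def mult_nonneg_nonpos)
  then show ?thesis using False by simp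
qed

text \<open>Continuity for the weak topology, stated with filters so that no topology on the type
  of measures is needed.\<close>

definition weakly_continuous :: "('a::topological_space measure \<Rightarrow> real) \<Rightarrow> bool" where
  "weakly_continuous \<Phi> \<longleftrightarrow> (\<forall>F. \<forall>\<rho>\<in>PBaire.
     (\<forall>f\<in>test_functions. ((\<lambda>\<pi>. integral\<^sup>L \<pi> f) \<longlongrightarrow> integral\<^sup>L \<rho> f) F) \<longrightarrow> (\<Phi> \<longlongrightarrow> \<Phi> \<rho>) F)"

text \<open>Measurability is demanded besides weak continuity because the sigma-algebra of
  \<open>prob_algebra\<close> is generated by evaluations alone and need not contain all weakly open
  sets.\<close>

definition weak_test_functions :: "('a::topological_space measure \<Rightarrow> real) set" where
  "weak_test_functions =
     {\<Phi> \<in> borel_measurable (prob_algebra Baire). weakly_continuous \<Phi>} \<inter> bounded_functions PBaire"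

lemma weak_test_functions_const: "(\<lambda>_. c) \<in> weak_test_functions"
  by (auto simp: weak_test_functions_def weakly_continuous_def bounded_functions_const)

lemma function_subspace_weak_test_functions:
  "function_subspace (weak_test_functions :: ('a::topological_space measure \<Rightarrow> real) set)"
  unfolding function_subspace_def
proof (intro conjI ballI allI)
  show "(weak_test_functions :: ('a measure \<Rightarrow> real) set) \<noteq> {}"
    using weak_test_functions_const by blast
qed (auto simp: weak_test_functions_def weakly_continuous_def
    function_subspace_add[OF function_subspace_bounded_functions]
    function_subspace_scale[OF function_subspace_bounded_functions] intro!: tendsto_intros)

lemma weak_test_functions_max:
  "\<Phi> \<in> weak_test_functions \<Longrightarrow> \<Psi> \<in> weak_test_functions \<Longrightarrow> (\<lambda>x. max (\<Phi> x) (\<Psi> x)) \<in> weak_test_functions"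
  by (auto simp: weak_test_functions_def weakly_continuous_def bounded_functions_max intro!: tendsto_intros)

lemma weak_test_functions_mult:
  "\<Phi> \<in> weak_test_functions \<Longrightarrow> \<Psi> \<in> weak_test_functions \<Longrightarrow> (\<lambda>x. \<Phi> x * \<Psi> x) \<in> weak_test_functions"
  by (auto simp: weak_test_functions_def weakly_continuous_def bounded_functions_mult intro!: tendsto_intros)

lemma weak_test_functions_prod:
  assumes "\<And>i. i \<in> I \<Longrightarrow> \<Phi> i \<in> weak_test_functions"
  shows "(\<lambda>\<pi>. \<Prod>i\<in>I. \<Phi> i \<pi>) \<in> weak_test_functions"
  using assms
  by (induction I rule: infinite_finite_induct)
    (auto simp: weak_test_functions_const intro!: weak_test_functions_mult)

lemma weak_test_functions_integral:
  assumes f: "f \<in> test_functions"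
  shows "(\<lambda>\<pi>. integral\<^sup>L \<pi> f) \<in> weak_test_functions"
proof -
  obtain B where B: "\<And>x. \<bar>f x\<bar> \<le> B" using test_functions_bounded[OF f] by blast
  have "(\<lambda>\<pi>. integral\<^sup>L \<pi> f) \<in> bounded_functions PBaire"
    using B by (intro bounded_functionsI abs_integral_le_bound) (auto simp: PBaire_iff)
  moreover have "(\<lambda>\<pi>. integral\<^sup>L \<pi> f) \<in> borel_measurable (prob_algebra Baire)"
    unfolding prob_algebra_def
    using test_functionsD(1)[OF f]
    by (intro measurable_restrict_space1 integral_measurable_subprob_algebra)
  ultimately show ?thesis
    using f by (auto simp: weak_test_functions_def weakly_continuous_def)
qed

lemma integral_cutoff_tendsto:
  assumes \<pi>: "\<pi> \<in> PBaire" and f: "f \<in> test_functions"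
  shows "(\<lambda>k. integral\<^sup>L \<pi> (cutoff f k)) \<longlonglongrightarrow> measure \<pi> {x. 0 < f x}"
proof -
  interpret prob_space \<pi> using \<pi> by (simp add: PBaire_iff)
  have [measurable]: "f \<in> borel_measurable \<pi>" "cutoff f k \<in> borel_measurable \<pi>" for k
    using f measurable_PBaire[OF \<pi>] test_functionsD(1) cutoff_test_functions by blast+
  have "{x \<in> space \<pi>. 0 < f x} \<in> sets \<pi>" by measurable
  then have [measurable]: "{x. 0 < f x} \<in> sets \<pi>" by (simp add: PBaire_space[OF \<pi>])
  have "(\<lambda>k. integral\<^sup>L \<pi> (cutoff f k)) \<longlonglongrightarrow> (\<integral>x. indicator {x. 0 < f x} x \<partial>\<pi>)"
    by (rule integral_dominated_convergence[where w="\<lambda>_. 1"])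
      (auto simp: cutoff_tendsto cutoff_bounds)
  then show ?thesis by (simp add: PBaire_space[OF \<pi>])
qed

text \<open>Daniell's theorem on \<open>P(S)\<close> yields a measure on the sigma-algebra generated
  by the positivity sets of the function class; this identifies it with the one generated by the
  evaluations.\<close>

lemma sigma_sets_weak_test_functions:
  "sigma_sets PBaire {{\<pi>\<in>PBaire. 0 < \<Phi> \<pi>} |\<Phi>. \<Phi> \<in> weak_test_functions} =
     sets (prob_algebra (Baire :: 'a::topological_space measure))"
  (is "sigma_sets _ ?G = _")
proof
  have "{\<pi>\<in>PBaire. 0 < \<Phi> \<pi>} \<in> sets (prob_algebra Baire)" if "\<Phi> \<in> weak_test_functions"
    for \<Phi> :: "'a measure \<Rightarrow> real"
  proof -
    have "\<Phi> \<in> borel_measurable (prob_algebra Baire)" using that by (simp add: weak_test_functions_def)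
    then show ?thesis by measurable
  qed
  then show "sigma_sets PBaire ?G \<subseteq> sets (prob_algebra (Baire :: 'a measure))"
    by (intro sets.sigma_sets_subset) auto
next
  define N where "N = sigma PBaire ?G"
  have G: "?G \<subseteq> Pow PBaire" by auto
  have space_N: "space N = PBaire" and sets_N: "sets N = sigma_sets PBaire ?G"
    using G unfolding N_def by (simp_all add: space_measure_of sets_measure_of)
  have meas: "\<Phi> \<in> borel_measurable N" if "\<Phi> \<in> weak_test_functions" for \<Phi>
    unfolding borel_measurable_iff_greater
  proof
    fix a
    have "{\<pi> \<in> space N. a < \<Phi> \<pi>} = {\<pi>\<in>PBaire. 0 < \<Phi> \<pi> - a}" by (auto simp: space_N)
    also have "\<dots> \<in> ?G"
      using function_subspace_diff[OF function_subspace_weak_test_functions that weak_test_functions_const[of a]]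
      by (intro CollectI exI[of _ "\<lambda>\<pi>. \<Phi> \<pi> - a"]) simp
    finally show "{\<pi> \<in> space N. a < \<Phi> \<pi>} \<in> sets N" unfolding sets_N by (rule sigma_sets.Basic)
  qed
  \<comment> \<open>Measurability of the identity is the missing inclusion. It is enough to evaluate
    on cozero sets, an intersection-stable generator of the Baire sets, and there the evaluation is
    a limit of integrals of cutoffs.\<close>
  have "(\<lambda>\<pi>. \<pi>) \<in> measurable N (prob_algebra Baire)"
  proof (rule measurable_prob_algebra_generated[OF sets_Baire Int_stable_cozero_sets])
    show "prob_space \<pi>" "sets \<pi> = sets Baire" if "\<pi> \<in> space N" for \<pi>
      using that by (simp_all add: space_N PBaire_iff)
    fix A :: "'a set" assume "A \<in> cozero_sets"
    then obtain f where f: "f \<in> test_functions" "A = {x. 0 < f x}" by (auto simp: cozero_sets_def)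
    have "(\<lambda>\<pi>. measure \<pi> A) \<in> borel_measurable N"
    proof (rule borel_measurable_LIMSEQ_real)
      show "(\<lambda>k. integral\<^sup>L \<pi> (cutoff f k)) \<longlonglongrightarrow> measure \<pi> A" if "\<pi> \<in> space N" for \<pi>
        using that f by (auto simp: space_N intro: integral_cutoff_tendsto)
      show "(\<lambda>\<pi>. integral\<^sup>L \<pi> (cutoff f k)) \<in> borel_measurable N" for k
        using f by (intro meas weak_test_functions_integral cutoff_test_functions)
    qed
    then have "(\<lambda>\<pi>. ennreal (measure \<pi> A)) \<in> borel_measurable N" by measurable
    moreover have "emeasure \<pi> A = ennreal (measure \<pi> A)" if "\<pi> \<in> space N" for \<pi>
    proof -
      interpret prob_space \<pi> using that by (simp add: space_N PBaire_iff)
      show ?thesis by (rule emeasure_eq_measure)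
    qed
    ultimately show "(\<lambda>\<pi>. emeasure \<pi> A) \<in> borel_measurable N"
      by (simp cong: measurable_cong)
  qed auto
  then have "A \<in> sets N" if "A \<in> sets (prob_algebra (Baire :: 'a measure))" for A
    using measurable_sets[OF _ that, of "\<lambda>\<pi>. \<pi>" N] sets.sets_into_space[OF that]
    by (simp add: space_N Int_absorb2)
  then show "sets (prob_algebra (Baire :: 'a measure)) \<subseteq> sigma_sets PBaire ?G"
    unfolding sets_N by auto
qed

theorem weak_representing_measure:
  fixes L :: "('a::topological_space measure \<Rightarrow> real) \<Rightarrow> real"
  assumes linear: "linear_functional_on (bounded_functions PBaire) L"
    and le: "\<And>\<Phi> c. \<Phi> \<in> bounded_functions PBaire \<Longrightarrow> (\<And>\<pi>. \<pi> \<in> PBaire \<Longrightarrow> \<Phi> \<pi> \<le> c) \<Longrightarrow> L \<Phi> \<le> c"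
    and tight: "\<And>e. 0 < e \<Longrightarrow> \<exists>K. compact K \<and> K \<in> sets Baire \<and> L (\<lambda>\<pi>. measure \<pi> (- K)) \<le> e"
  shows "\<exists>\<nu>. prob_space \<nu> \<and> sets \<nu> = sets (prob_algebra (Baire :: 'a measure)) \<and>
    (\<forall>\<Phi>\<in>weak_test_functions. L \<Phi> = integral\<^sup>L \<nu> \<Phi>)"
proof -
  note V = function_subspace_bounded_functions[of "PBaire :: 'a measure set"]
  note W = function_subspace_weak_test_functions[where 'a='a]
  have WV: "\<Phi> \<in> bounded_functions PBaire" if "\<Phi> \<in> weak_test_functions" for \<Phi> :: "'a measure \<Rightarrow> real"
    using that by (simp add: weak_test_functions_def)
  have ge: "c \<le> L \<Phi>" if "\<Phi> \<in> bounded_functions PBaire" "\<And>\<pi>. \<pi> \<in> PBaire \<Longrightarrow> c \<le> \<Phi> \<pi>" for \<Phi> c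
    using le[OF function_subspace_uminus[OF V that(1)], of "-c"] that
    by (simp add: linear_functional_on_uminus[OF linear])
  have mono: "L \<Phi> \<le> L \<Psi>"
    if "\<Phi> \<in> bounded_functions PBaire" "\<Psi> \<in> bounded_functions PBaire" "\<And>\<pi>. \<pi> \<in> PBaire \<Longrightarrow> \<Phi> \<pi> \<le> \<Psi> \<pi>" for \<Phi> \<Psi>
    using ge[OF function_subspace_diff[OF V that(2,1)], of 0] that
    by (simp add: linear_functional_on_diff[OF V linear])
  have const: "L (\<lambda>_. c) = c" for c
    using le[OF bounded_functions_const, of c c] ge[OF bounded_functions_const, of c c] by simp
  have prob_bounded: "(\<lambda>\<pi>. measure \<pi> A) \<in> bounded_functions PBaire" for A :: "'a set"
    by (rule bounded_functionsI[of _ _ 1]) (simp add: PBaire_iff prob_space.prob_le_1)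
  interpret daniell_integral "PBaire :: 'a measure set" weak_test_functions L
  proof
    show "linear_functional_on weak_test_functions L"
      using linear WV unfolding linear_functional_on_def by blast
    show "0 \<le> L \<Phi>" if "\<Phi> \<in> weak_test_functions" "\<And>x. x \<in> PBaire \<Longrightarrow> 0 \<le> \<Phi> x" for \<Phi>
      using ge[OF WV] that by blast
    show "\<exists>B. \<forall>x\<in>PBaire. \<bar>\<Phi> x\<bar> \<le> B" if "\<Phi> \<in> weak_test_functions" for \<Phi> :: "'a measure \<Rightarrow> real"
      using WV[OF that] by (simp add: bounded_functions_def)
    show "(\<lambda>k. L (\<Phi> k)) \<longlonglongrightarrow> 0"
      if \<Phi>: "\<And>k. \<Phi> k \<in> weak_test_functions" and dec: "\<And>\<pi>. \<pi> \<in> PBaire \<Longrightarrow> decseq (\<lambda>k. \<Phi> k \<pi>)"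
        and lim: "\<And>\<pi>. \<pi> \<in> PBaire \<Longrightarrow> (\<lambda>k. \<Phi> k \<pi>) \<longlonglongrightarrow> 0" for \<Phi> :: "nat \<Rightarrow> 'a measure \<Rightarrow> real"
    proof (rule ccontr)
      have nonneg: "0 \<le> \<Phi> k \<pi>" if "\<pi> \<in> PBaire" for k \<pi>
        using decseq_ge[OF dec lim] that by blast
      have L_dec: "L (\<Phi> k) \<le> L (\<Phi> j)" if "j \<le> k" for j k
        using decseqD[OF dec that] by (intro mono WV \<Phi>)
      assume "\<not> (\<lambda>k. L (\<Phi> k)) \<longlonglongrightarrow> 0"
      then obtain r where r: "0 < r" "\<And>n. \<exists>k\<ge>n. r \<le> \<bar>L (\<Phi> k)\<bar>"
        unfolding LIMSEQ_iff by (auto simp: not_less)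
      have L_ge: "r \<le> L (\<Phi> j)" for j
      proof -
        obtain k where k: "j \<le> k" "r \<le> \<bar>L (\<Phi> k)\<bar>" using r(2) by blast
        moreover have "0 \<le> L (\<Phi> k)" using nonneg by (intro ge WV \<Phi>)
        ultimately show ?thesis using L_dec[OF k(1)] by simp
      qed
      obtain B where B: "0 < B" "\<And>\<pi>. \<pi> \<in> PBaire \<Longrightarrow> \<bar>\<Phi> 0 \<pi>\<bar> \<le> B"
        using WV[OF \<Phi>[of 0]] by (rule bounded_functionsE) blast
      \<comment> \<open>Half of the lower bound \<open>r\<close> of all \<open>L (\<Phi> j)\<close>
        is kept as the lower bound for \<open>\<Phi> j (\<pi> j)\<close>; the other half pays for
        the tail penalties.\<close>
      define e where "e = r / 2"
      have e: "0 < e" using r by (simp add: e_def)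
      define \<delta> :: "nat \<Rightarrow> real" where "\<delta> m = (1 / 2) ^ m" for m
      have \<delta>: "0 < \<delta> m" for m by (simp add: \<delta>_def)
      \<comment> \<open>One factor \<open>\<delta> m\<close> cancels against the penalty weight
        \<open>B / \<delta> m\<close>. The other leaves \<open>e / 4 * \<delta> m\<close>, and since
        the \<open>\<delta> m\<close> sum to at most 2, all penalties together cost at most
        \<open>e / 2\<close>.\<close>
      have "\<exists>K. compact K \<and> K \<in> sets Baire \<and> L (\<lambda>\<pi>. measure \<pi> (- K)) \<le> e * \<delta> m * \<delta> m / (4 * B)" for m
        using e \<delta>[of m] B(1) by (intro tight) simp
      then obtain K where K: "\<And>m. compact (K m)" "\<And>m. K m \<in> sets Baire"
        "\<And>m. L (\<lambda>\<pi>. measure \<pi> (- K m)) \<le> e * \<delta> m * \<delta> m / (4 * B)" by metis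
      \<comment> \<open>If no such measure existed, \<open>\<Phi> j\<close> would lie below
        \<open>e\<close> plus the penalties on all of \<open>PBaire\<close>, and \<open>L\<close>
        would give it a value below \<open>r\<close>. Only finitely many penalties,
        \<open>m < j\<close>, enter, because \<open>L\<close> is only known to be finitely additive.
        Conversely, as \<open>\<Phi> j \<le> B\<close>, the weight \<open>B / \<delta> m\<close>
        forces the tail of the chosen measure down to \<open>\<delta> m\<close>.\<close>
      have "\<exists>\<pi>\<in>PBaire. e + (\<Sum>m<j. B / \<delta> m * measure \<pi> (- K m)) \<le> \<Phi> j \<pi>" for j
      proof (rule ccontr)
        assume *: "\<not> ?thesis"
        let ?s = "\<lambda>\<pi>. \<Sum>m<j. B / \<delta> m * measure \<pi> (- K m)"
        have sV: "?s \<in> bounded_functions PBaire"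
          by (intro function_subspace_sum[OF V] function_subspace_scale[OF V] prob_bounded)
        have "L (\<Phi> j) \<le> L (\<lambda>\<pi>. e + ?s \<pi>)"
          using * by (intro mono WV \<Phi> function_subspace_add[OF V] bounded_functions_const sV) force
        also have "\<dots> = e + (\<Sum>m<j. L (\<lambda>\<pi>. B / \<delta> m * measure \<pi> (- K m)))"
        proof -
          have "L ?s = (\<Sum>m<j. L (\<lambda>\<pi>. B / \<delta> m * measure \<pi> (- K m)))"
            by (intro linear_functional_on_sum[OF V linear] function_subspace_scale[OF V prob_bounded])
          then show ?thesis
            using linear_functional_on_add[OF linear bounded_functions_const sV, of e] by (simp only: const)
        qed
        also have "\<dots> \<le> e + (\<Sum>m<j. e / 4 * \<delta> m)"
        proof (intro add_left_mono sum_mono)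
          fix m
          have "L (\<lambda>\<pi>. B / \<delta> m * measure \<pi> (- K m)) = B / \<delta> m * L (\<lambda>\<pi>. measure \<pi> (- K m))"
            by (rule linear_functional_on_scale[OF linear prob_bounded])
          also have "\<dots> \<le> B / \<delta> m * (e * \<delta> m * \<delta> m / (4 * B))"
            using B(1) \<delta>[of m] by (intro mult_left_mono K(3)) simp
          also have "\<dots> = e / 4 * \<delta> m" using B(1) \<delta>[of m] by (simp add: field_simps)
          finally show "L (\<lambda>\<pi>. B / \<delta> m * measure \<pi> (- K m)) \<le> e / 4 * \<delta> m" .
        qed
        also have "\<dots> = e + e / 4 * (\<Sum>m<j. \<delta> m)" by (simp add: sum_distrib_left)
        also have "(\<Sum>m<j. \<delta> m) \<le> 2" unfolding \<delta>_def by (simp add: sum_gp_strict)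
        then have "e + e / 4 * (\<Sum>m<j. \<delta> m) \<le> e + e / 4 * 2" using e by (intro add_left_mono mult_left_mono) auto
        finally show False using L_ge[of j] e by (simp add: e_def)
      qed
      then obtain \<pi> where \<pi>: "\<And>j. \<pi> j \<in> PBaire"
        "\<And>j. e + (\<Sum>m<j. B / \<delta> m * measure (\<pi> j) (- K m)) \<le> \<Phi> j (\<pi> j)" by metis
      have \<Phi>_ge: "e \<le> \<Phi> j (\<pi> j)" for j
      proof -
        have "0 \<le> (\<Sum>m<j. B / \<delta> m * measure (\<pi> j) (- K m))"
          using B(1) \<delta> by (intro sum_nonneg) (simp add: less_imp_le)
        then show ?thesis using \<pi>(2)[of j] by linarith
      qed
      have tail: "measure (\<pi> j) (- K m) \<le> \<delta> m" if "m < j" for j m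
      proof -
        have "B / \<delta> m * measure (\<pi> j) (- K m) \<le> (\<Sum>m<j. B / \<delta> m * measure (\<pi> j) (- K m))"
          using B(1) \<delta> that by (intro member_le_sum) (auto simp: less_imp_le)
        also have "\<dots> \<le> B"
          using \<pi>(2)[of j] B(2)[OF \<pi>(1)[of j]] decseqD[OF dec[OF \<pi>(1)[of j]], of 0 j] e by simp
        finally show ?thesis using B(1) \<delta>[of m] by (simp add: field_simps)
      qed
      have "eventually (\<lambda>j. measure (\<pi> j) (- K m) \<le> \<delta> m) sequentially" for m
        using eventually_gt_at_top[of m] by eventually_elim (rule tail)
      moreover have "\<delta> \<longlonglongrightarrow> 0" unfolding \<delta>_def by (rule LIMSEQ_power_zero) simp
      ultimately obtain F \<rho> where F: "F \<le> sequentially" "F \<noteq> bot" and \<rho>: "\<rho> \<in> PBaire"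
        and conv: "\<And>f. f \<in> test_functions \<Longrightarrow> ((\<lambda>j. integral\<^sup>L (\<pi> j) f) \<longlongrightarrow> integral\<^sup>L \<rho> f) F"
        using tight_sequence_cluster_point[of \<pi> K \<delta>] \<pi>(1) K(1,2) by blast
      \<comment> \<open>For fixed \<open>k\<close> and \<open>j \<ge> k\<close>, monotonicity gives
        \<open>\<Phi> k (\<pi> j) \<ge> \<Phi> j (\<pi> j) \<ge> e\<close>; weak continuity of
        \<open>\<Phi> k\<close> carries this to \<open>\<rho>\<close>.\<close>
      have "e \<le> \<Phi> k \<rho>" for k
      proof (rule tendsto_lowerbound[OF _ _ F(2)])
        have "weakly_continuous (\<Phi> k)" using \<Phi>[of k] by (simp add: weak_test_functions_def)
        moreover have "\<forall>f\<in>test_functions. ((\<lambda>\<pi>. integral\<^sup>L \<pi> f) \<longlongrightarrow> integral\<^sup>L \<rho> f) (filtermap \<pi> F)"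
          using conv by (simp add: filterlim_filtermap)
        ultimately have "(\<Phi> k \<longlongrightarrow> \<Phi> k \<rho>) (filtermap \<pi> F)"
          using \<rho> unfolding weakly_continuous_def by blast
        then show "((\<lambda>j. \<Phi> k (\<pi> j)) \<longlongrightarrow> \<Phi> k \<rho>) F" by (simp add: filterlim_filtermap)
        have "eventually (\<lambda>j. e \<le> \<Phi> k (\<pi> j)) sequentially"
          using eventually_ge_at_top[of k]
          by eventually_elim (use \<Phi>_ge decseqD[OF dec[OF \<pi>(1)]] order_trans in blast)
        then show "eventually (\<lambda>j. e \<le> \<Phi> k (\<pi> j)) F" using F(1) by (rule filter_leD[rotated])
      qed
      then have "e \<le> 0" by (intro LIMSEQ_le_const[OF lim[OF \<rho>]]) auto
      then show False using e by simp
    qed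
  qed (simp_all add: W weak_test_functions_const weak_test_functions_max const)
  obtain \<nu> where \<nu>: "prob_space \<nu>" "sets \<nu> = sigma_sets PBaire G"
    "\<And>\<Phi>. \<Phi> \<in> weak_test_functions \<Longrightarrow> L \<Phi> = integral\<^sup>L \<nu> \<Phi>"
    using representing_measure by blast
  then show ?thesis
    using sigma_sets_weak_test_functions[where 'a='a] by (intro exI[of _ \<nu>]) (simp add: G_def)
qed

section \<open>Mixtures of product measures\<close>

lemma space_prodS: "space (prodS n (Baire :: 'a::topological_space measure)) = PiE {..<n} (\<lambda>_. UNIV)"
  by (simp add: prodS_def space_PiM)

lemma sets_PiM_PBaire:
  "\<pi> \<in> PBaire \<Longrightarrow> sets (PiM {..<n::nat} (\<lambda>_. \<pi>)) = sets (prodS n Baire)"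
  unfolding prodS_def by (intro sets_PiM_cong) (auto simp: PBaire_iff)

lemma prob_space_PiM_PBaire: "\<pi> \<in> PBaire \<Longrightarrow> prob_space (PiM {..<n::nat} (\<lambda>_. \<pi>))"
  by (intro prob_space_PiM) (simp add: PBaire_iff)

lemma emeasure_PiM_PBaire:
  assumes "\<pi> \<in> PBaire" "\<And>i::nat. i < n \<Longrightarrow> A i \<in> sets Baire"
  shows "emeasure (PiM {..<n} (\<lambda>_. \<pi>)) (PiE {..<n} A) = (\<Prod>i<n. emeasure \<pi> (A i))"
proof -
  interpret product_prob_space "\<lambda>_. \<pi>" "{..<n}"
    using assms(1) by (simp add: PBaire_iff product_prob_space_def product_prob_space_axioms_def
        product_sigma_finite_def prob_space_imp_sigma_finite)
  show ?thesis using assms by (intro emeasure_PiM) (auto simp: PBaire_iff)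
qed

text \<open>On a rectangle the product measure is a product of evaluations of \<open>\<pi>\<close>,
  and rectangles form an intersection-stable generator.\<close>

lemma measurable_PiM_PBaire [measurable]:
  "(\<lambda>\<pi>. PiM {..<n} (\<lambda>_. \<pi>)) \<in> measurable (prob_algebra Baire) (prob_algebra (prodS n Baire))"
proof (rule measurable_prob_algebra_generated)
  let ?M = "\<lambda>_::nat. Baire :: 'a measure"
  show "sets (prodS n Baire) = sigma_sets (PiE {..<n} (\<lambda>i. space (?M i))) (prod_algebra {..<n} ?M)"
    unfolding prodS_def by (rule sets_PiM)
  show "Int_stable (prod_algebra {..<n} ?M)" by (rule Int_stable_prod_algebra)
  show "prod_algebra {..<n} ?M \<subseteq> Pow (PiE {..<n} (\<lambda>i. space (?M i)))" by (rule prod_algebra_sets_into_space)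
  show "prob_space (PiM {..<n} (\<lambda>_. \<pi>))" if "\<pi> \<in> PBaire" for \<pi> :: "'a measure"
    using that by (rule prob_space_PiM_PBaire)
  show "sets (PiM {..<n} (\<lambda>_. \<pi>)) = sets (prodS n Baire)" if "\<pi> \<in> PBaire" for \<pi> :: "'a measure"
    using that by (rule sets_PiM_PBaire)
  fix A assume "A \<in> prod_algebra {..<n} ?M"
  then obtain X where X: "A = PiE {..<n} X" "\<And>i. i < n \<Longrightarrow> X i \<in> sets (Baire :: 'a measure)"
    by (rule prod_algebraE_all) auto
  have "(\<lambda>\<pi>. \<Prod>i<n. emeasure \<pi> (X i)) \<in> borel_measurable (prob_algebra (Baire :: 'a measure))"
    using X(2) unfolding prob_algebra_def
    by (intro borel_measurable_prod_ennreal measurable_restrict_space1 measurable_emeasure_subprob_algebra) auto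
  then show "(\<lambda>\<pi>. emeasure (PiM {..<n} (\<lambda>_. \<pi>)) A) \<in> borel_measurable (prob_algebra (Baire :: 'a measure))"
    using X by (simp add: measurable_cong[OF emeasure_PiM_PBaire])
qed

definition mixture :: "'a::topological_space measure measure \<Rightarrow> nat \<Rightarrow> (nat \<Rightarrow> 'a) measure" where
  "mixture \<nu> n = \<nu> \<bind> (\<lambda>\<pi>. PiM {..<n} (\<lambda>_. \<pi>))"

lemma measurable_kernel:
  assumes "sets \<nu> = sets (prob_algebra (Baire :: 'a::topological_space measure))"
  shows "(\<lambda>\<pi>. PiM {..<n} (\<lambda>_. \<pi>)) \<in> measurable \<nu> (prob_algebra (prodS n (Baire :: 'a measure)))"
  using measurable_PiM_PBaire by (simp cong: measurable_cong_sets add: measurable_cong_sets[OF assms refl])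

context
  fixes \<nu> :: "'a::topological_space measure measure"
  assumes prob_\<nu>: "prob_space \<nu>" and sets_\<nu>: "sets \<nu> = sets (prob_algebra (Baire :: 'a measure))"
begin

lemma space_mixing: "space \<nu> = PBaire"
  by (rule sets_eq_imp_space_eq[OF sets_\<nu>])

lemma mixing_in_prob_algebra: "\<nu> \<in> space (prob_algebra (prob_algebra Baire))"
  using prob_\<nu> sets_\<nu> by (simp add: space_prob_algebra)

lemma sets_mixture: "sets (mixture \<nu> n) = sets (prodS n Baire)"
  unfolding mixture_def
  using sets_bind'[OF mixing_in_prob_algebra measurable_PiM_PBaire] .

lemma prob_space_mixture: "prob_space (mixture \<nu> n)"
  unfolding mixture_def
  using prob_space_bind'[OF mixing_in_prob_algebra measurable_PiM_PBaire] .

lemma integral_mixture: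
  fixes f :: "(nat \<Rightarrow> 'a) \<Rightarrow> real"
  assumes "f \<in> borel_measurable (prodS n Baire)" "\<And>x. \<bar>f x\<bar> \<le> B"
  shows "integral\<^sup>L (mixture \<nu> n) f = (\<integral>\<pi>. Iprod n f \<pi> \<partial>\<nu>)"
  unfolding mixture_def Iprod_def
proof (rule integral_bind[OF assms(1) assms(2) _ _ AE_I2])
  interpret prob_space \<nu> by (rule prob_\<nu>)
  show "finite_measure \<nu>" by (rule finite_measure_axioms)
  show "(\<lambda>\<pi>. PiM {..<n} (\<lambda>_. \<pi>)) \<in> measurable \<nu> (subprob_algebra (prodS n Baire))"
    by (rule measurable_prob_algebraD[OF measurable_kernel[OF sets_\<nu>]])
  show "emeasure (PiM {..<n} (\<lambda>_. \<pi>)) (space (PiM {..<n} (\<lambda>_. \<pi>))) \<le> ennreal 1" if "\<pi> \<in> space \<nu>" for \<pi>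
    using prob_space.emeasure_space_1[OF prob_space_PiM_PBaire[of \<pi>]] that by (simp add: space_mixing)
qed

lemma measure_mixture:
  assumes "A \<in> sets (prodS n Baire)"
  shows "measure (mixture \<nu> n) A = (\<integral>\<pi>. measure (PiM {..<n} (\<lambda>_. \<pi>)) A \<partial>\<nu>)"
proof -
  have "A \<inter> space (mixture \<nu> n) = A"
    using sets.sets_into_space[OF assms] sets_eq_imp_space_eq[OF sets_mixture] by (simp add: Int_absorb2)
  then have "measure (mixture \<nu> n) A = integral\<^sup>L (mixture \<nu> n) (indicator A)" by simp
  also have "\<dots> = (\<integral>\<pi>. Iprod n (indicator A) \<pi> \<partial>\<nu>)"
    using assms by (intro integral_mixture[of _ _ 1]) (auto simp: indicator_def)
  also have "\<dots> = (\<integral>\<pi>. measure (PiM {..<n} (\<lambda>_. \<pi>)) A \<partial>\<nu>)"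
  proof (intro Bochner_Integration.integral_cong refl)
    fix \<pi> assume "\<pi> \<in> space \<nu>"
    then have "A \<in> sets (PiM {..<n} (\<lambda>_. \<pi>))" using assms by (simp add: space_mixing sets_PiM_PBaire)
    then have "A \<inter> space (PiM {..<n} (\<lambda>_. \<pi>)) = A" using sets.sets_into_space by blast
    then show "Iprod n (indicator A) \<pi> = measure (PiM {..<n} (\<lambda>_. \<pi>)) A" by (simp add: Iprod_def)
  qed
  finally show ?thesis .
qed

text \<open>Reindexing along an injection sends \<open>\<pi>^n\<close> to \<open>\<pi>^m\<close> for
  every single \<open>\<pi>\<close>, hence also under the mixture. Permutations of the indices give
  exchangeability, and the inclusion of the first \<open>n\<close> indices gives
  extendibility.\<close>

lemma distr_mixture_reindex:
  assumes f: "inj_on f {..<m}" "f \<in> {..<m} \<rightarrow> {..<n}"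
  shows "distr (mixture \<nu> n) (prodS m Baire) (\<lambda>y. \<lambda>i\<in>{..<m}. y (f i)) = mixture \<nu> m"
proof -
  have meas: "(\<lambda>y. \<lambda>i\<in>{..<m}. y (f i)) \<in> measurable (prodS n (Baire :: 'a measure)) (prodS m Baire)"
    unfolding prodS_def using f(2) by (intro measurable_restrict measurable_component_singleton) auto
  have "distr (mixture \<nu> n) (prodS m Baire) (\<lambda>y. \<lambda>i\<in>{..<m}. y (f i)) =
    \<nu> \<bind> (\<lambda>\<pi>. distr (PiM {..<n} (\<lambda>_. \<pi>)) (prodS m Baire) (\<lambda>y. \<lambda>i\<in>{..<m}. y (f i)))"
    unfolding mixture_def
    by (rule distr_bind[OF measurable_prob_algebraD[OF measurable_kernel[OF sets_\<nu>]] prob_space.not_empty[OF prob_\<nu>] meas])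
  also have "\<dots> = \<nu> \<bind> (\<lambda>\<pi>. PiM {..<m} (\<lambda>_. \<pi>))"
  proof (rule bind_cong[OF refl])
    fix \<pi> assume "\<pi> \<in> space \<nu>"
    then have \<pi>: "\<pi> \<in> PBaire" by (simp add: space_mixing)
    have "distr (PiM {..<n} (\<lambda>_. \<pi>)) (prodS m Baire) (\<lambda>y. \<lambda>i\<in>{..<m}. y (f i)) =
      distr (PiM {..<n} (\<lambda>_. \<pi>)) (PiM {..<m} (\<lambda>_. \<pi>)) (\<lambda>y. \<lambda>i\<in>{..<m}. y (f i))"
      by (intro distr_cong refl sets_PiM_PBaire[OF \<pi>, symmetric])
    also have "\<dots> = PiM {..<m} (\<lambda>_. \<pi>)"
      using \<pi> f by (intro distr_PiM_reindex) (auto simp: PBaire_iff)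
    finally show "distr (PiM {..<n} (\<lambda>_. \<pi>)) (prodS m Baire) (\<lambda>y. \<lambda>i\<in>{..<m}. y (f i)) = PiM {..<m} (\<lambda>_. \<pi>)" .
  qed
  finally show ?thesis by (simp add: mixture_def)
qed

lemma exchangeable_mixture: "exchangeable_law n (mixture \<nu> n)"
  unfolding exchangeable_law_def
proof (intro conjI allI impI prob_space_mixture sets_mixture distr_mixture_reindex)
  fix \<sigma> assume \<sigma>: "\<sigma> permutes {..<n}"
  show "inj_on \<sigma> {..<n}" by (rule permutes_inj_on[OF \<sigma>])
  show "\<sigma> \<in> {..<n} \<rightarrow> {..<n}" using permutes_in_image[OF \<sigma>] by blast
qed

lemma extendible_mixture:
  assumes "n \<le> N"
  shows "extendible_law n N (mixture \<nu> n)"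
  unfolding extendible_law_def
  using distr_mixture_reindex[of "\<lambda>i. i" n N] assms
  by (intro exI[of _ "mixture \<nu> N"]) (auto simp: exchangeable_mixture restrict_def)

end

text \<open>The constant function 1 is admissible, so the norm is always at least 1 and only the
  upper bound carries information.\<close>

lemma normT_eq_1_iff:
  fixes P :: "(nat \<Rightarrow> 'a::topological_space) measure"
  assumes P: "prob_space P"
  shows "normT n P = 1 \<longleftrightarrow>
    (\<forall>g\<in>borel_measurable (prodS n (Baire :: 'a measure)). (\<exists>B. \<forall>x. \<bar>g x\<bar> \<le> B) \<longrightarrow>
      (\<forall>\<pi>\<in>PBaire. \<bar>Iprod n g \<pi>\<bar> \<le> 1) \<longrightarrow> \<bar>integral\<^sup>L P g\<bar> \<le> 1)"
proof -
  let ?S = "{g. g \<in> borel_measurable (prodS n (Baire :: 'a measure)) \<and> (\<exists>B. \<forall>x. \<bar>g x\<bar> \<le> B) \<and>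
    (\<forall>\<pi>\<in>PBaire. \<bar>Iprod n g \<pi>\<bar> \<le> 1)}"
  interpret prob_space P by (rule P)
  have "Iprod n (\<lambda>_. 1) \<pi> = 1" if "\<pi> \<in> PBaire" for \<pi> :: "'a measure"
    using prob_space.prob_space[OF prob_space_PiM_PBaire[OF that]] by (simp add: Iprod_def)
  then have "(\<lambda>_. 1) \<in> ?S" by auto
  then have ge: "1 \<le> normT n P"
    unfolding normT_def by (intro SUP_upper2[of "\<lambda>_. 1"]) (simp_all add: prob_space)
  have "normT n P = 1 \<longleftrightarrow> normT n P \<le> 1" using ge by auto
  also have "\<dots> \<longleftrightarrow> (\<forall>g\<in>?S. \<bar>integral\<^sup>L P g\<bar> \<le> 1)"
    unfolding normT_def SUP_le_iff by simp
  finally show ?thesis by auto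
qed

text \<open>The integral of \<open>g\<close> is the \<open>\<nu>\<close>-average of the numbers
  \<open>I(g, \<pi>)\<close>, all of which lie in \<open>[-1,1]\<close>.\<close>

lemma mixture_imp_normT:
  assumes \<nu>: "prob_space \<nu>" "sets \<nu> = sets (prob_algebra (Baire :: 'a::topological_space measure))"
  shows "normT n (mixture \<nu> n) = 1"
  unfolding normT_eq_1_iff[OF prob_space_mixture[OF \<nu>]]
proof (intro ballI impI)
  fix g assume g: "g \<in> borel_measurable (prodS n (Baire :: 'a measure))" "\<exists>B. \<forall>x. \<bar>g x\<bar> \<le> B"
    "\<forall>\<pi>\<in>PBaire. \<bar>Iprod n g \<pi>\<bar> \<le> 1"
  then obtain B where "\<And>x. \<bar>g x\<bar> \<le> B" by blast
  from integral_mixture[OF \<nu> g(1) this] show "\<bar>integral\<^sup>L (mixture \<nu> n) g\<bar> \<le> 1"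
    using abs_integral_le_bound[OF \<nu>(1), of "Iprod n g" 1] g(3) by (simp add: space_mixing[OF \<nu>])
qed

section \<open>Empirical measures\<close>

text \<open>This turns an \<open>n\<close>-fold integral against an empirical measure into a finite
  average over index maps. The two sides are compared on rectangles, where both are products of
  relative frequencies.\<close>

lemma PiM_uniform_count_measure:
  assumes S: "finite S" "S \<noteq> {}" and I: "finite I"
  shows "PiM I (\<lambda>_. uniform_count_measure S) = uniform_count_measure (PiE I (\<lambda>_. S))"
proof -
  have U: "prob_space (uniform_count_measure S)" using S by (rule prob_space_uniform_count_measure)
  interpret product_prob_space "\<lambda>_. uniform_count_measure S" I
    using U by (simp add: product_prob_space_def product_prob_space_axioms_def
        product_sigma_finite_def prob_space_imp_sigma_finite)
  have fin: "finite (PiE I (\<lambda>_. S))" using S I by (intro finite_PiE) auto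
  show ?thesis
  proof (rule PiM_eqI[OF I, symmetric])
    have "sets (PiM I (\<lambda>_. uniform_count_measure S)) = sets (PiM I (\<lambda>_. count_space S))"
      by (intro sets_PiM_cong) (simp_all add: sets_uniform_count_measure)
    also have "\<dots> = Pow (PiE I (\<lambda>_. S))"
      using count_space_PiM_finite[OF I, of "\<lambda>_. S"] S by (simp add: countable_finite)
    finally show "sets (uniform_count_measure (PiE I (\<lambda>_. S))) = sets (PiM I (\<lambda>_. uniform_count_measure S))"
      by (simp add: sets_uniform_count_measure)
    fix A assume A: "\<And>i. i \<in> I \<Longrightarrow> A i \<in> sets (uniform_count_measure S)"
    then have AS: "A i \<subseteq> S" if "i \<in> I" for i using that by (auto simp: sets_uniform_count_measure)
    then have "PiE I A \<subseteq> PiE I (\<lambda>_. S)" by (intro PiE_mono)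
    then have "emeasure (uniform_count_measure (PiE I (\<lambda>_. S))) (PiE I A) =
      ennreal ((\<Prod>i\<in>I. real (card (A i))) / (\<Prod>i\<in>I. real (card S)))"
      using I fin by (simp add: emeasure_uniform_count_measure card_PiE)
    also have "\<dots> = (\<Prod>i\<in>I. ennreal (real (card (A i)) / real (card S)))"
      by (simp add: prod_dividef[symmetric] prod_ennreal del: prod_constant)
    also have "\<dots> = (\<Prod>i\<in>I. emeasure (uniform_count_measure S) (A i))"
      using AS S by (intro prod.cong) (simp_all add: emeasure_uniform_count_measure)
    finally show "emeasure (uniform_count_measure (PiE I (\<lambda>_. S))) (PiE I A) =
      (\<Prod>i\<in>I. emeasure (uniform_count_measure S) (A i))" .
  qed
qed

text \<open>As an image of the uniform distribution on indices it counts coinciding points with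
  multiplicity, and \<open>y\<close> is automatically measurable because all sets of indices
  are.\<close>

definition empirical_measure :: "nat \<Rightarrow> (nat \<Rightarrow> 'a::topological_space) \<Rightarrow> 'a measure" where
  "empirical_measure N y = distr (uniform_count_measure {..<N}) Baire y"

lemma measurable_uniform_count: "f \<in> S \<rightarrow> space M \<Longrightarrow> f \<in> measurable (uniform_count_measure S) M"
  by (simp add: measurable_def space_uniform_count_measure sets_uniform_count_measure)

lemma empirical_measure_PBaire:
  assumes "0 < N"
  shows "empirical_measure N y \<in> PBaire"
proof -
  interpret prob_space "uniform_count_measure {..<N}"
    using assms by (intro prob_space_uniform_count_measure) auto
  show ?thesis
    unfolding empirical_measure_def PBaire_iff
    by (auto intro!: prob_space_distr measurable_uniform_count)
qed

lemma Iprod_empirical_measure: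
  assumes N: "0 < N" and g: "g \<in> borel_measurable (prodS n (Baire :: 'a::topological_space measure))"
  shows "Iprod n g (empirical_measure N y) =
    (\<Sum>s\<in>PiE {..<n} (\<lambda>_. {..<N}). g (\<lambda>i\<in>{..<n}. y (s i))) / real N ^ n"
proof -
  let ?U = "uniform_count_measure {..<N}"
  have U: "prob_space ?U" using N by (intro prob_space_uniform_count_measure) auto
  have y: "y \<in> measurable ?U Baire" by (intro measurable_uniform_count) auto
  have B: "prob_space (distr ?U Baire y)" by (rule prob_space.prob_space_distr[OF U y])
  have "PiM {..<n} (\<lambda>_. empirical_measure N y) =
     distr (PiM {..<n} (\<lambda>_. ?U)) (PiM {..<n} (\<lambda>_. distr ?U Baire y)) (compose {..<n} y)"
    unfolding empirical_measure_def
    using distr_PiM_finite_prob_space'[of "{..<n}" "\<lambda>_. ?U" "\<lambda>_. distr ?U Baire y" y] U B y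
    by (simp add: distr_cong[OF refl sets_distr refl])
  also have "\<dots> = distr (PiM {..<n} (\<lambda>_. ?U)) (prodS n Baire) (compose {..<n} y)"
    unfolding prodS_def by (intro distr_cong refl sets_PiM_cong) auto
  finally have PiM: "PiM {..<n} (\<lambda>_. empirical_measure N y) = \<dots>" .
  have PU: "PiM {..<n} (\<lambda>_. ?U) = uniform_count_measure (PiE {..<n} (\<lambda>_. {..<N}))"
    using N by (intro PiM_uniform_count_measure) auto
  have "Iprod n g (empirical_measure N y) =
     (\<integral>s. g (compose {..<n} y s) \<partial>uniform_count_measure (PiE {..<n} (\<lambda>_. {..<N})))"
    unfolding Iprod_def PiM PU
    by (intro integral_distr g measurable_uniform_count) (auto simp: space_prodS compose_def)
  also have "\<dots> = (\<Sum>s\<in>PiE {..<n} (\<lambda>_. {..<N}). g (compose {..<n} y s)) / real N ^ n"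
    by (subst integral_uniform_count_measure) (auto simp: card_PiE intro: finite_PiE)
  finally show ?thesis by (simp add: compose_def)
qed

text \<open>Union bound over at most \<open>n * n\<close> ordered pairs \<open>i \<noteq> j\<close>:
  a map with \<open>s i = s j\<close> is determined by its values off \<open>j\<close>, which leaves
  at most \<open>N ^ (n - 1)\<close> maps. Multiplying by \<open>N\<close> keeps the statement free
  of division and of the exponent \<open>n - 1\<close>.\<close>

lemma card_non_injective_le:
  assumes "0 < N"
  shows "card {s \<in> PiE {..<n} (\<lambda>_. {..<N}). \<not> inj_on s {..<n}} * N \<le> n * n * N ^ n"
proof -
  let ?P = "PiE {..<n} (\<lambda>_. {..<N})"
  let ?E = "\<lambda>(i, j). {s \<in> ?P. s i = s j}"
  let ?J = "{(i, j). i < n \<and> j < n \<and> i \<noteq> j}"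
  have J: "finite ?J" "card ?J \<le> n * n"
  proof -
    have "?J \<subseteq> {..<n} \<times> {..<n}" by auto
    from finite_subset[OF this] card_mono[OF _ this] show "finite ?J" "card ?J \<le> n * n" by auto
  qed
  have fin: "finite ?P" by (intro finite_PiE) auto
  have le: "card (?E p) * N \<le> N ^ n" if p: "p \<in> ?J" for p
  proof -
    obtain i j where ij: "p = (i, j)" "i < n" "j < n" "i \<noteq> j" using p by auto
    let ?Q = "PiE ({..<n} - {j}) (\<lambda>_. {..<N})"
    have "card (?E p) \<le> card ?Q"
    proof (rule card_inj_on_le)
      show "inj_on (\<lambda>s. restrict s ({..<n} - {j})) (?E p)"
      proof (rule inj_onI)
        fix s t assume st: "s \<in> ?E p" "t \<in> ?E p" "restrict s ({..<n} - {j}) = restrict t ({..<n} - {j})"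
        have eq: "s k = t k" if "k < n" "k \<noteq> j" for k
          using fun_cong[OF st(3), of k] that by simp
        have "s j = t j" using eq[of i] ij st(1,2) by simp
        then show "s = t"
          using st(1,2) ij eq by (intro PiE_ext[of s "{..<n}" "\<lambda>_. {..<N}" t]) auto
      qed
      show "(\<lambda>s. restrict s ({..<n} - {j})) ` ?E p \<subseteq> ?Q"
      proof (rule image_subsetI)
        fix s assume "s \<in> ?E p"
        then have "s \<in> ?P" by (simp add: ij(1))
        then have "\<forall>k\<in>{..<n} - {j}. s k \<in> {..<N}" by (auto simp: PiE_iff)
        then show "restrict s ({..<n} - {j}) \<in> ?Q" by (simp only: restrict_PiE_iff)
      qed
      show "finite ?Q" by (intro finite_PiE) simp_all
    qed
    also have "card ?Q = N ^ (n - 1)" using ij by (simp add: card_PiE)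
    finally have "card (?E p) * N \<le> N ^ (n - 1) * N" by simp
    also have "\<dots> = N ^ n" using ij by (cases n) auto
    finally show ?thesis .
  qed
  have "{s \<in> ?P. \<not> inj_on s {..<n}} \<subseteq> (\<Union>p\<in>?J. ?E p)" by (auto simp: inj_on_def)
  then have "card {s \<in> ?P. \<not> inj_on s {..<n}} \<le> card (\<Union>p\<in>?J. ?E p)"
    using J(1) fin by (intro card_mono) auto
  also have "\<dots> \<le> (\<Sum>p\<in>?J. card (?E p))" by (rule card_UN_le[OF J(1)])
  finally have "card {s \<in> ?P. \<not> inj_on s {..<n}} * N \<le> (\<Sum>p\<in>?J. card (?E p)) * N" by simp
  also have "\<dots> = (\<Sum>p\<in>?J. card (?E p) * N)" by (rule sum_distrib_right)
  also have "\<dots> \<le> (\<Sum>p\<in>?J. N ^ n)" by (intro sum_mono le)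
  also have "\<dots> = card ?J * N ^ n" by simp
  also have "\<dots> \<le> n * n * N ^ n" using J(2) by simp
  finally show ?thesis .
qed

text \<open>Exchangeability speaks of permutations of all \<open>N\<close> coordinates, whereas the
  index maps at hand are injections of the first \<open>n\<close>. The complements of domain and
  image have equal size, so any bijection between them completes \<open>s\<close>.\<close>

lemma injection_extends_to_permutation:
  fixes s :: "nat \<Rightarrow> nat"
  assumes s: "s \<in> {..<n} \<rightarrow> {..<N}" "inj_on s {..<n}" and n: "n \<le> N"
  obtains \<sigma> where "\<sigma> permutes {..<N}" "\<And>i. i < n \<Longrightarrow> \<sigma> i = s i"
proof -
  have "s ` {..<n} \<subseteq> {..<N}" using s(1) by auto
  moreover have "{..<n} \<subseteq> {..<N}" using n by simp
  ultimately have "card ({..<N} - {..<n}) = card ({..<N} - s ` {..<n})"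
    using s(2) by (simp add: card_Diff_subset card_image)
  then obtain h where h: "bij_betw h ({..<N} - {..<n}) ({..<N} - s ` {..<n})"
    using finite_same_card_bij[of "{..<N} - {..<n}" "{..<N} - s ` {..<n}"] by auto
  define \<sigma> where "\<sigma> i = (if i < n then s i else if i < N then h i else i)" for i
  have "bij_betw \<sigma> ({..<n} \<union> ({..<N} - {..<n})) (s ` {..<n} \<union> ({..<N} - s ` {..<n}))"
  proof (rule bij_betw_combine)
    show "bij_betw \<sigma> {..<n} (s ` {..<n})"
      using s(2) by (auto simp: bij_betw_def \<sigma>_def inj_on_def)
    show "bij_betw \<sigma> ({..<N} - {..<n}) ({..<N} - s ` {..<n})"
      using h by (subst bij_betw_cong[of _ _ h]) (auto simp: \<sigma>_def)
  qed auto
  moreover have "{..<n} \<union> ({..<N} - {..<n}) = {..<N}" "s ` {..<n} \<union> ({..<N} - s ` {..<n}) = {..<N}"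
    using s(1) n by auto
  ultimately have "bij_betw \<sigma> {..<N} {..<N}" by simp
  then have "\<sigma> permutes {..<N}" using n by (intro bij_imp_permutes) (auto simp: \<sigma>_def)
  then show thesis using that by (simp add: \<sigma>_def)
qed

lemma integrable_prodS:
  fixes g :: "(nat \<Rightarrow> 'a::topological_space) \<Rightarrow> real"
  assumes P: "prob_space P" "sets P = sets (prodS n (Baire :: 'a measure))"
    and g: "g \<in> borel_measurable (prodS n Baire)" "\<And>x. \<bar>g x\<bar> \<le> B"
  shows "integrable P g"
proof -
  interpret prob_space P by (rule P(1))
  show ?thesis
    using g by (intro integrable_const_bound[of _ B]) (auto simp: measurable_cong_sets[OF P(2) refl])
qed

lemma Iprod_affine:
  fixes g :: "(nat \<Rightarrow> 'a::topological_space) \<Rightarrow> real"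
  assumes "\<pi> \<in> PBaire" "g \<in> borel_measurable (prodS n Baire)" "\<And>x. \<bar>g x\<bar> \<le> B"
  shows "Iprod n (\<lambda>x. a * g x + b) \<pi> = a * Iprod n g \<pi> + b"
proof -
  interpret prob_space "PiM {..<n} (\<lambda>_. \<pi>)" by (rule prob_space_PiM_PBaire[OF assms(1)])
  have "integrable (PiM {..<n} (\<lambda>_. \<pi>)) g"
    by (rule integrable_prodS[OF prob_space_axioms sets_PiM_PBaire[OF assms(1)] assms(2,3)])
  then show ?thesis by (simp add: Iprod_def prob_space)
qed

lemma extendible_imp_normT:
  fixes P :: "(nat \<Rightarrow> 'a::topological_space) measure"
  assumes P: "prob_space P" and ext: "\<And>N. n \<le> N \<Longrightarrow> extendible_law n N P"
  shows "normT n P = 1"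
  unfolding normT_eq_1_iff[OF P]
proof (intro ballI impI)
  fix g assume g: "g \<in> borel_measurable (prodS n (Baire :: 'a measure))" and "\<exists>B. \<forall>x. \<bar>g x\<bar> \<le> B"
    and I: "\<forall>\<pi>\<in>PBaire. \<bar>Iprod n g \<pi>\<bar> \<le> 1"
  then obtain B where B: "\<And>x. \<bar>g x\<bar> \<le> B" by blast
  let ?E = "integral\<^sup>L P g"
  \<comment> \<open>Each non-injective index map contributes an error of at most
    \<open>2 * B\<close>, and their share among all maps is at most
    \<open>n * n / N\<close>.\<close>
  have bound: "\<bar>?E\<bar> \<le> 1 + 2 * B * real (n * n) * inverse (real N)" if N: "n \<le> N" "0 < N" for N
  proof -
    obtain Q where Q: "prob_space Q" "sets Q = sets (prodS N (Baire :: 'a measure))"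
      and exch: "\<And>\<sigma>. \<sigma> permutes {..<N} \<Longrightarrow> distr Q (prodS N Baire) (\<lambda>x. \<lambda>i\<in>{..<N}. x (\<sigma> i)) = Q"
      and restr: "distr Q (prodS n Baire) (\<lambda>y. restrict y {..<n}) = P"
      using ext[OF N(1)] by (auto simp: extendible_law_def exchangeable_law_def)
    have meas: "(\<lambda>y. \<lambda>i\<in>{..<m}. y (s i)) \<in> measurable (prodS N (Baire :: 'a measure)) (prodS m Baire)"
      if "s \<in> {..<m} \<rightarrow> {..<N}" for s m
      unfolding prodS_def using that by (intro measurable_restrict measurable_component_singleton) auto
    have measQ: "measurable Q M = measurable (prodS N (Baire :: 'a measure)) M" for M :: "'c measure"
      by (rule measurable_cong_sets[OF Q(2) refl])
    define a where "a s = (\<integral>y. g (\<lambda>i\<in>{..<n}. y (s i)) \<partial>Q)" for s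
    \<comment> \<open>An injective \<open>s\<close> is the beginning of a permutation of the
      \<open>N\<close> coordinates, so the coordinates it selects have the same joint law as the
      first \<open>n\<close>.\<close>
    have a_inj: "a s = ?E" if s: "s \<in> {..<n} \<rightarrow> {..<N}" "inj_on s {..<n}" for s
    proof -
      obtain \<sigma> where \<sigma>: "\<sigma> permutes {..<N}" "\<And>i. i < n \<Longrightarrow> \<sigma> i = s i"
        using injection_extends_to_permutation[OF s N(1)] by blast
      have \<sigma>N: "\<sigma> \<in> {..<N} \<rightarrow> {..<N}" using permutes_in_image[OF \<sigma>(1)] by blast
      have r: "(\<lambda>y. restrict y {..<n}) \<in> measurable (prodS N (Baire :: 'a measure)) (prodS n Baire)"
        using meas[of "\<lambda>i. i" n] N(1) by (auto simp: restrict_def Pi_iff)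
      have "?E = (\<integral>y. g (restrict y {..<n}) \<partial>Q)"
        unfolding restr[symmetric] using g r by (intro integral_distr) (simp_all add: measQ)
      also have "\<dots> = (\<integral>y. g (restrict y {..<n}) \<partial>distr Q (prodS N Baire) (\<lambda>x. \<lambda>i\<in>{..<N}. x (\<sigma> i)))"
        by (simp only: exch[OF \<sigma>(1)])
      also have "\<dots> = (\<integral>x. g (restrict (\<lambda>i\<in>{..<N}. x (\<sigma> i)) {..<n}) \<partial>Q)"
        using meas[OF \<sigma>N] measurable_compose[OF r g] by (intro integral_distr) (simp_all add: measQ)
      also have "(\<lambda>x. restrict (\<lambda>i\<in>{..<N}. x (\<sigma> i)) {..<n}) = (\<lambda>y. \<lambda>i\<in>{..<n}. y (s i))"
        using \<sigma>(2) N(1) by (auto simp: fun_eq_iff restrict_def)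
      finally show ?thesis by (simp add: a_def restrict_def)
    qed
    have a_le: "\<bar>a s\<bar> \<le> B" for s
      unfolding a_def by (intro abs_integral_le_bound Q B)
    have E_le: "\<bar>?E\<bar> \<le> B" by (intro abs_integral_le_bound P B)
    let ?S = "PiE {..<n} (\<lambda>_. {..<N})"
    let ?J = "{s \<in> ?S. \<not> inj_on s {..<n}}"
    have fin: "finite ?S" by (intro finite_PiE) auto
    have int: "integrable Q (\<lambda>y. g (\<lambda>i\<in>{..<n}. y (s i)))" if "s \<in> ?S" for s
      using meas[of s n] that B g
      by (intro integrable_prodS[OF Q, of _ B] measurable_compose[OF _ g]) (auto simp: PiE_iff)
    \<comment> \<open>Integrating over \<open>Q\<close> turns the empirical averages into the
      average of all \<open>a s\<close>. Its absolute value is at most 1 because every empirical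
      measure is an admissible \<open>\<pi>\<close>.\<close>
    have "(\<Sum>s\<in>?S. a s) / real N ^ n = (\<integral>y. Iprod n g (empirical_measure N y) \<partial>Q)"
      unfolding Iprod_empirical_measure[OF N(2) g] a_def using int by simp
    moreover have "\<bar>\<integral>y. Iprod n g (empirical_measure N y) \<partial>Q\<bar> \<le> 1"
      using I empirical_measure_PBaire[OF N(2)] by (intro abs_integral_le_bound Q) auto
    ultimately have "\<bar>(\<Sum>s\<in>?S. a s) / real N ^ n\<bar> \<le> 1" by (simp only:)
    then have avg: "\<bar>\<Sum>s\<in>?S. a s\<bar> \<le> real N ^ n" using N(2) by (simp add: abs_divide divide_le_eq)
    have "real N ^ n * ?E = (\<Sum>s\<in>?S. ?E)" by (simp add: card_PiE)
    also have "\<dots> = (\<Sum>s\<in>?S. a s) + (\<Sum>s\<in>?S. ?E - a s)" by (simp add: sum_subtractf)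
    also have "(\<Sum>s\<in>?S. ?E - a s) = (\<Sum>s\<in>?J. ?E - a s)"
    proof (rule sum.mono_neutral_right[OF fin])
      show "\<forall>s\<in>?S - ?J. ?E - a s = 0"
      proof
        fix s assume "s \<in> ?S - ?J"
        then have "s \<in> {..<n} \<rightarrow> {..<N}" "inj_on s {..<n}" by (simp_all add: PiE_def)
        then show "?E - a s = 0" using a_inj by simp
      qed
    qed simp
    finally have "\<bar>real N ^ n * ?E\<bar> \<le> real N ^ n + \<bar>\<Sum>s\<in>?J. ?E - a s\<bar>" using avg by linarith
    also have "\<bar>\<Sum>s\<in>?J. ?E - a s\<bar> \<le> (\<Sum>s\<in>?J. 2 * B)"
    proof (rule order_trans[OF sum_abs sum_mono])
      show "\<bar>?E - a s\<bar> \<le> 2 * B" for s using a_le[of s] E_le by linarith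
    qed
    also have "\<dots> = 2 * B * real (card ?J)" by simp
    finally have "real N ^ n * \<bar>?E\<bar> \<le> real N ^ n + 2 * B * real (card ?J)" by (simp add: abs_mult)
    then have "real N * (real N ^ n * \<bar>?E\<bar>) \<le> real N * (real N ^ n + 2 * B * real (card ?J))"
      by (rule mult_left_mono) simp
    also have "\<dots> = real N * real N ^ n + 2 * B * real (card ?J * N)" by (simp add: algebra_simps)
    \<comment> \<open>Evaluating \<open>B\<close> at an arbitrary point yields
      \<open>0 \<le> B\<close>, which monotonicity in the number of non-injective maps
      requires.\<close>
    also have "\<dots> \<le> real N * real N ^ n + 2 * B * real (n * n * N ^ n)"
      using card_non_injective_le[OF N(2), of n] B[of undefined]
      by (intro add_left_mono mult_left_mono of_nat_mono) auto
    finally have "real N ^ n * (real N * \<bar>?E\<bar>) \<le> real N ^ n * (real N + 2 * B * real (n * n))"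
      by (simp add: algebra_simps)
    then have "real N * \<bar>?E\<bar> \<le> real N + 2 * B * real (n * n)"
      using N(2) by (subst (asm) mult_le_cancel_left_pos) auto
    then show ?thesis using N(2) by (simp add: field_simps)
  qed
  have "(\<lambda>N. 1 + 2 * B * real (n * n) * inverse (real N)) \<longlonglongrightarrow> 1 + 2 * B * real (n * n) * 0"
    by (intro tendsto_intros lim_inverse_n)
  moreover have "eventually (\<lambda>N. \<bar>?E\<bar> \<le> 1 + 2 * B * real (n * n) * inverse (real N)) sequentially"
    using eventually_ge_at_top[of n] eventually_gt_at_top[of 0] by eventually_elim (rule bound)
  ultimately show "\<bar>?E\<bar> \<le> 1" by (intro tendsto_lowerbound[of _ _ sequentially]) auto
qed

section \<open>From the norm condition to a mixture\<close>

text \<open>The norm condition is symmetric, while positivity of the functional requires a one-sided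
  bound. Since \<open>I(g, \<pi>)\<close> ranges within \<open>[-B, c]\<close>, recentring
  \<open>g\<close> at the midpoint of this interval turns one into the other.\<close>

lemma normT_imp_integral_le:
  fixes P :: "(nat \<Rightarrow> 'a::topological_space) measure"
  assumes P: "prob_space P" "sets P = sets (prodS n (Baire :: 'a measure))" and norm: "normT n P = 1"
    and g: "g \<in> borel_measurable (prodS n Baire)" "\<And>x. \<bar>g x\<bar> \<le> B"
    and I: "\<And>\<pi>. \<pi> \<in> PBaire \<Longrightarrow> Iprod n g \<pi> \<le> c"
  shows "integral\<^sup>L P g \<le> c"
proof (rule field_le_epsilon)
  interpret prob_space P by (rule P(1))
  fix e :: real assume e: "0 < e"
  have I_abs: "\<bar>Iprod n g \<pi>\<bar> \<le> B" if "\<pi> \<in> PBaire" for \<pi>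
    unfolding Iprod_def by (intro abs_integral_le_bound prob_space_PiM_PBaire that g(2))
  \<comment> \<open>\<open>m\<close> is the midpoint of \<open>[-B, c]\<close> and \<open>r\<close>
    its half-length, enlarged by \<open>e\<close> so that division by \<open>r\<close> is possible
    even if \<open>c = - B\<close>. Then \<open>m + r = c + e\<close>.\<close>
  define m where "m = (c - B) / 2"
  define r where "r = (c + B) / 2 + e"
  \<comment> \<open>Some probability measure is needed for the interval to be nonempty; the
    empirical measure of a single point will do.\<close>
  have "- B \<le> c"
    using I_abs[OF empirical_measure_PBaire[of 1 undefined]] I[OF empirical_measure_PBaire[of 1 undefined]]
    by (simp add: abs_le_iff)
  then have "0 \<le> (c + B) / 2" by simp
  then have r: "0 < r" using e unfolding r_def by (rule add_nonneg_pos)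
  define h where "h x = (1 / r) * g x + (- m / r)" for x
  have "\<bar>Iprod n h \<pi>\<bar> \<le> 1" if "\<pi> \<in> PBaire" for \<pi>
  proof -
    have "Iprod n h \<pi> = (Iprod n g \<pi> - m) / r"
      unfolding h_def Iprod_affine[OF that g] by (simp add: diff_divide_distrib)
    moreover have "\<bar>Iprod n g \<pi> - m\<bar> \<le> r"
      using I[OF that] I_abs[OF that] e by (auto simp: m_def r_def abs_le_iff field_simps)
    ultimately show ?thesis using r by (simp add: abs_divide)
  qed
  moreover have "h \<in> borel_measurable (prodS n Baire)" unfolding h_def using g(1) by measurable
  moreover have "\<exists>C. \<forall>x. \<bar>h x\<bar> \<le> C"
  proof (intro exI allI)
    fix x
    have "\<bar>h x\<bar> \<le> \<bar>(1 / r) * g x\<bar> + \<bar>- m / r\<bar>" unfolding h_def by (rule abs_triangle_ineq)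
    also have "\<bar>(1 / r) * g x\<bar> \<le> (1 / r) * B" using r g(2)[of x] by (simp add: abs_mult divide_right_mono)
    finally show "\<bar>h x\<bar> \<le> (1 / r) * B + \<bar>- m / r\<bar>" by simp
  qed
  ultimately have "\<bar>integral\<^sup>L P h\<bar> \<le> 1" using norm unfolding normT_eq_1_iff[OF P(1)] by blast
  moreover have "integral\<^sup>L P h = (integral\<^sup>L P g - m) / r"
    unfolding h_def using integrable_prodS[OF P g] by (simp add: diff_divide_distrib prob_space)
  ultimately have "integral\<^sup>L P g - m \<le> r" using r by (simp add: abs_le_iff field_simps)
  then show "integral\<^sup>L P g \<le> c + e" by (simp add: m_def r_def field_simps)
qed

section \<open>Product functions on \<open>S^n\<close>\<close>

lemma borel_measurable_prod_coordinates:
  assumes "\<And>i. i < n \<Longrightarrow> f i \<in> borel_measurable (Baire :: 'a::topological_space measure)"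
  shows "(\<lambda>x. \<Prod>i<n. f i (x i) :: real) \<in> borel_measurable (prodS n Baire)"
  unfolding prodS_def using assms
  by (intro borel_measurable_prod measurable_compose[OF measurable_component_singleton]) auto

text \<open>Fubini. For test functions \<open>f i\<close> the right-hand side is a product of weakly
  continuous functions of \<open>\<pi>\<close>: on product functions the prescribed values of
  \<open>L\<close> meet the functions that \<open>\<nu>\<close> represents.\<close>

lemma Iprod_prod_coordinates:
  assumes \<pi>: "\<pi> \<in> PBaire" and f: "\<And>i. i < n \<Longrightarrow> f i \<in> borel_measurable Baire" "\<And>i x. \<bar>f i x\<bar> \<le> B i"
  shows "Iprod n (\<lambda>x. \<Prod>i<n. f i (x i)) \<pi> = (\<Prod>i<n. integral\<^sup>L \<pi> (f i))"
proof -
  have prob: "prob_space \<pi>" using \<pi> by (simp add: PBaire_iff)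
  have int: "integrable \<pi> (f i)" if "i < n" for i
    using f(2)[of i] measurable_PBaire[OF \<pi> f(1)[OF that]] prob_space.finite_measure[OF prob]
    by (intro finite_measure.integrable_const_bound[where B="B i"]) auto
  interpret product_sigma_finite "\<lambda>_. \<pi>"
    by (simp add: product_sigma_finite_def prob_space_imp_sigma_finite prob)
  show ?thesis
    unfolding Iprod_def using int by (intro product_integral_prod) auto
qed

text \<open>By dominated convergence, cutoffs turn equal integrals of product functions into equal
  measures of boxes with cozero sides. These boxes are an intersection-stable generator of the
  product sigma-algebra.\<close>

lemma prodS_eqI:
  fixes P Q :: "(nat \<Rightarrow> 'a::topological_space) measure"
  assumes P: "prob_space P" "sets P = sets (prodS n (Baire :: 'a measure))"
    and Q: "prob_space Q" "sets Q = sets (prodS n (Baire :: 'a measure))"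
    and eq: "\<And>f. (\<And>i. f i \<in> test_functions) \<Longrightarrow> (\<And>i x. \<bar>f i x\<bar> \<le> 1) \<Longrightarrow>
      (\<integral>x. (\<Prod>i<n. f i (x i)) \<partial>P) = (\<integral>x. (\<Prod>i<n. f i (x i)) \<partial>Q)"
  shows "P = Q"
proof -
  let ?\<Omega> = "PiE {..<n} (\<lambda>_. UNIV :: 'a set)"
  let ?E = "{{f\<in>?\<Omega>. \<forall>i\<in>{..<n}. f i \<in> A i} |A. A \<in> {..<n} \<rightarrow> (cozero_sets :: 'a set set)}"
  have UNIV_cozero: "UNIV \<in> cozero_sets"
    unfolding cozero_sets_def by (intro CollectI exI[of _ "\<lambda>_. 1"]) (simp add: test_functions_const)
  have "sets (prodS n (Baire :: 'a measure)) = sets (PiM {..<n} (\<lambda>_. sigma UNIV cozero_sets :: 'a measure))"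
    unfolding prodS_def by (intro sets_PiM_cong) (simp_all add: sets_Baire)
  also have "\<dots> = sets (sigma ?\<Omega> {{f\<in>?\<Omega>. \<forall>i\<in>j. f i \<in> A i} |A j. j \<in> {{..<n}} \<and> A \<in> Pi j (\<lambda>_. cozero_sets)})"
    using UNIV_cozero by (intro sets_PiM_sigma exI[of _ "{UNIV}"]) auto
  also have "{{f\<in>?\<Omega>. \<forall>i\<in>j. f i \<in> A i} |A j. j \<in> {{..<n}} \<and> A \<in> Pi j (\<lambda>_. cozero_sets)} = ?E" by auto
  also have "sets (sigma ?\<Omega> ?E) = sigma_sets ?\<Omega> ?E" by (rule sets_measure_of) auto
  finally have sets_eq: "sets (prodS n (Baire :: 'a measure)) = sigma_sets ?\<Omega> ?E" .
  have measure_tendsto: "(\<lambda>k. \<integral>x. (\<Prod>i<n. cutoff (f i) k (x i)) \<partial>R) \<longlonglongrightarrow>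
      measure R {x\<in>?\<Omega>. \<forall>i\<in>{..<n}. 0 < f i (x i)}"
    if R: "prob_space R" "sets R = sets (prodS n (Baire :: 'a measure))" and f: "\<And>i. f i \<in> test_functions" for R f
  proof -
    interpret prob_space R by (rule R)
    let ?A = "{x\<in>?\<Omega>. \<forall>i\<in>{..<n}. 0 < f i (x i)}"
    have space_R: "space R = ?\<Omega>" using sets_eq_imp_space_eq[OF R(2)] by (simp add: space_prodS)
    have f_meas: "f i \<in> borel_measurable Baire" for i by (rule test_functionsD(1)[OF f])
    have "{x. 0 < f i x} \<in> cozero_sets" for i using f by (auto simp: cozero_sets_def)
    then have "?A \<in> ?E" by (intro CollectI exI[of _ "\<lambda>i. {x. 0 < f i x}"]) auto
    then have A: "?A \<in> sets R" unfolding R(2) sets_eq by (rule sigma_sets.Basic)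
    have "(\<lambda>k. \<integral>x. (\<Prod>i<n. cutoff (f i) k (x i)) \<partial>R) \<longlonglongrightarrow> (\<integral>x. indicator ?A x \<partial>R)"
    proof (rule integral_dominated_convergence[where w="\<lambda>_. 1"])
      show "(\<lambda>x. \<Prod>i<n. cutoff (f i) k (x i)) \<in> borel_measurable R" for k
        using borel_measurable_prod_coordinates[of n "\<lambda>i. cutoff (f i) k"]
          test_functionsD(1)[OF cutoff_test_functions[OF f]]
        by (simp add: measurable_cong_sets[OF R(2) refl])
      show "AE x in R. norm (\<Prod>i<n. cutoff (f i) k (x i)) \<le> 1" for k
        by (auto simp: abs_prod cutoff_bounds intro!: AE_I2 prod_le_1)
      show "AE x in R. (\<lambda>k. \<Prod>i<n. cutoff (f i) k (x i)) \<longlonglongrightarrow> indicator ?A x"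
      proof (rule AE_I2)
        fix x assume x: "x \<in> space R"
        have "(\<lambda>k. \<Prod>i<n. cutoff (f i) k (x i)) \<longlonglongrightarrow> (\<Prod>i<n. indicator {x. 0 < f i x} (x i))"
          by (intro tendsto_prod cutoff_tendsto)
        also have "(\<Prod>i<n. indicator {x. 0 < f i x} (x i)) = (indicator ?A x :: real)"
          using x by (auto simp: space_R indicator_def prod_zero_iff)
        finally show "(\<lambda>k. \<Prod>i<n. cutoff (f i) k (x i)) \<longlonglongrightarrow> indicator ?A x" .
      qed
    qed (use A in auto)
    also have "(\<integral>x. indicator ?A x \<partial>R) = measure R ?A" using sets.sets_into_space[OF A] by (simp add: Int_absorb2)
    finally show ?thesis .
  qed
  show ?thesis
  proof (rule measure_eqI_generator_eq[where E="?E" and \<Omega>="?\<Omega>" and A="\<lambda>_. ?\<Omega>"])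
    show "Int_stable ?E"
    proof (rule Int_stableI)
      fix a b assume "a \<in> ?E" "b \<in> ?E"
      then obtain A B where AB: "A \<in> {..<n} \<rightarrow> cozero_sets" "B \<in> {..<n} \<rightarrow> cozero_sets"
        "a = {f\<in>?\<Omega>. \<forall>i\<in>{..<n}. f i \<in> A i}" "b = {f\<in>?\<Omega>. \<forall>i\<in>{..<n}. f i \<in> B i}" by auto
      have "a \<inter> b = {f\<in>?\<Omega>. \<forall>i\<in>{..<n}. f i \<in> A i \<inter> B i}" using AB(3,4) by auto
      moreover have "(\<lambda>i. A i \<inter> B i) \<in> {..<n} \<rightarrow> cozero_sets"
        using AB(1,2) by (auto intro!: Int_stableD[OF Int_stable_cozero_sets])
      ultimately show "a \<inter> b \<in> ?E" by (intro CollectI exI[of _ "\<lambda>i. A i \<inter> B i"] conjI)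
    qed
    show "?E \<subseteq> Pow ?\<Omega>" by auto
    fix a assume "a \<in> ?E"
    then obtain A where A: "A \<in> {..<n} \<rightarrow> cozero_sets" "a = {f\<in>?\<Omega>. \<forall>i\<in>{..<n}. f i \<in> A i}" by auto
    then have "\<forall>i\<in>{..<n}. \<exists>f\<in>test_functions. A i = {x. 0 < f x}" by (auto simp: cozero_sets_def Pi_iff)
    from bchoice[OF this[unfolded Bex_def]]
    obtain f where f: "\<And>i. i < n \<Longrightarrow> f i \<in> test_functions \<and> A i = {x. 0 < f i x}" by auto
    \<comment> \<open>Padding with the zero function provides a test function at every index, as
      \<open>eq\<close> demands; the products involve only indices below \<open>n\<close>.\<close>
    define f' where "f' i = (if i < n then f i else (\<lambda>_. 0))" for i
    have f': "f' i \<in> test_functions" for i using f by (simp add: f'_def test_functions_const)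
    have a: "a = {x\<in>?\<Omega>. \<forall>i\<in>{..<n}. 0 < f' i (x i)}" using f A(2) by (auto simp: f'_def)
    have "measure P a = measure Q a"
    proof (rule LIMSEQ_unique)
      show "(\<lambda>k. \<integral>x. (\<Prod>i<n. cutoff (f' i) k (x i)) \<partial>P) \<longlonglongrightarrow> measure P a"
        unfolding a by (rule measure_tendsto[OF P f'])
      show "(\<lambda>k. \<integral>x. (\<Prod>i<n. cutoff (f' i) k (x i)) \<partial>P) \<longlonglongrightarrow> measure Q a"
        unfolding a eq[OF cutoff_test_functions[OF f'] cutoff_bounds(3)] by (rule measure_tendsto[OF Q f'])
    qed
    then show "emeasure P a = emeasure Q a"
      using P(1) Q(1) by (simp add: prob_space_def finite_measure.emeasure_eq_measure)
  next
    show "sets P = sigma_sets ?\<Omega> ?E" "sets Q = sigma_sets ?\<Omega> ?E" using P(2) Q(2) sets_eq by auto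
    show "range (\<lambda>_::nat. ?\<Omega>) \<subseteq> ?E"
    proof (rule image_subsetI)
      show "?\<Omega> \<in> ?E" using UNIV_cozero by (intro CollectI exI[of _ "\<lambda>_. UNIV"]) auto
    qed
    show "(\<Union>i::nat. ?\<Omega>) = ?\<Omega>" by simp
    show "emeasure P ?\<Omega> \<noteq> \<infinity>"
      using P(1) by (simp add: prob_space_def finite_measure.emeasure_finite)
  qed
qed

theorem normT_imp_mixture:
  fixes P :: "(nat \<Rightarrow> 'a::topological_space) measure"
  assumes P: "prob_space P" "sets P = sets (prodS n (Baire :: 'a measure))" and n: "0 < n"
    and tight: "\<And>e::real. 0 < e \<Longrightarrow> \<exists>K. compact K \<and> K \<in> sets Baire \<and> (\<integral>x. indicator (- K) (x 0) \<partial>P) \<le> e"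
    and norm: "normT n P = 1"
  obtains \<nu> where "prob_space \<nu>" "sets \<nu> = sets (prob_algebra (Baire :: 'a measure))" "P = mixture \<nu> n"
proof -
  define ok where "ok g \<longleftrightarrow> g \<in> borel_measurable (prodS n (Baire :: 'a measure)) \<and> (\<exists>B. \<forall>x. \<bar>g x\<bar> \<le> B)"
    for g :: "(nat \<Rightarrow> 'a) \<Rightarrow> real"
  \<comment> \<open>The graph of the prescribed functional. Agreement of \<open>w\<close> with
    \<open>Iprod n g\<close> is asked on \<open>PBaire\<close> only, since for other measures
    \<open>g\<close> need not be integrable and \<open>Iprod\<close> need not be additive in
    \<open>g\<close>.\<close>
  define R where "R = {(w, integral\<^sup>L P g) |w g. ok g \<and> (\<forall>\<pi>\<in>PBaire. w \<pi> = Iprod n g \<pi>)}"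
  have okI: "ok g" if "g \<in> borel_measurable (prodS n (Baire :: 'a measure))" "\<And>x. \<bar>g x\<bar> \<le> B" for g B
    using that unfolding ok_def by blast
  have ok_int: "integrable S g" if "ok g" "prob_space S" "sets S = sets (prodS n Baire)" for g S
    using that(1) integrable_prodS[OF that(2,3)] unfolding ok_def by blast
  have ok_intI: "integrable (PiM {..<n} (\<lambda>_. \<pi>)) g" if "ok g" "\<pi> \<in> PBaire" for g \<pi>
    using that by (intro ok_int prob_space_PiM_PBaire sets_PiM_PBaire)
  have R_I: "(w, integral\<^sup>L P g) \<in> R" if "ok g" "\<And>\<pi>. \<pi> \<in> PBaire \<Longrightarrow> w \<pi> = Iprod n g \<pi>" for w g
    using that unfolding R_def by blast
  have R_E: "\<exists>g. ok g \<and> e = integral\<^sup>L P g \<and> (\<forall>\<pi>\<in>PBaire. w \<pi> = Iprod n g \<pi>)" if "(w, e) \<in> R" for w e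
    using that unfolding R_def by blast
  have "\<exists>L. linear_functional_on (bounded_functions PBaire) L \<and>
    (\<forall>f\<in>bounded_functions PBaire. \<forall>c. (\<forall>x\<in>PBaire. f x \<le> c) \<longrightarrow> L f \<le> c) \<and> (\<forall>(w, e)\<in>R. L w = e)"
  proof (rule positive_extension)
    show "(PBaire :: 'a measure set) \<noteq> {}"
      using empirical_measure_PBaire[OF zero_less_one, of undefined] by (metis empty_iff)
    have "ok (\<lambda>_. 0)" by (rule okI[of _ 0]) auto
    from R_I[OF this refl] show "R \<noteq> {}" by (metis empty_iff)
  next
    fix v w d e assume v: "(v, d) \<in> R" and w: "(w, e) \<in> R"
    obtain f where f: "ok f" "d = integral\<^sup>L P f" "\<forall>\<pi>\<in>PBaire. v \<pi> = Iprod n f \<pi>"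
      using R_E[OF v] by blast
    obtain g where g: "ok g" "e = integral\<^sup>L P g" "\<forall>\<pi>\<in>PBaire. w \<pi> = Iprod n g \<pi>"
      using R_E[OF w] by blast
    have "ok (\<lambda>x. f x + g x)"
    proof -
      obtain B C where BC: "\<And>x. \<bar>f x\<bar> \<le> B" "\<And>x. \<bar>g x\<bar> \<le> C"
        using f(1) g(1) unfolding ok_def by blast
      have "\<bar>f x + g x\<bar> \<le> B + C" for x
        by (rule order_trans[OF abs_triangle_ineq add_mono[OF BC]])
      moreover have "(\<lambda>x. f x + g x) \<in> borel_measurable (prodS n Baire)"
        using f(1) g(1) unfolding ok_def by (intro borel_measurable_add) blast+
      ultimately show ?thesis by (intro okI)
    qed
    moreover have "d + e = integral\<^sup>L P (\<lambda>x. f x + g x)"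
      using ok_int[OF f(1) P] ok_int[OF g(1) P] by (simp add: f g)
    moreover have "v \<pi> + w \<pi> = Iprod n (\<lambda>x. f x + g x) \<pi>" if "\<pi> \<in> PBaire" for \<pi>
      using ok_intI[OF f(1) that] ok_intI[OF g(1) that] f(3) g(3) that by (simp add: Iprod_def)
    ultimately show "(\<lambda>x. v x + w x, d + e) \<in> R" using R_I[of "\<lambda>x. f x + g x" "\<lambda>x. v x + w x"] by simp
  next
    fix w e c assume w: "(w, e) \<in> R"
    obtain g where g: "ok g" "e = integral\<^sup>L P g" "\<forall>\<pi>\<in>PBaire. w \<pi> = Iprod n g \<pi>"
      using R_E[OF w] by blast
    have "ok (\<lambda>x. c * g x)"
    proof -
      obtain B where B: "\<And>x. \<bar>g x\<bar> \<le> B" using g(1) unfolding ok_def by blast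
      have "\<bar>c * g x\<bar> \<le> \<bar>c\<bar> * B" for x by (simp add: abs_mult mult_left_mono B)
      moreover have "(\<lambda>x. c * g x) \<in> borel_measurable (prodS n Baire)"
        using g(1) unfolding ok_def by (intro borel_measurable_times borel_measurable_const) blast
      ultimately show ?thesis by (intro okI)
    qed
    moreover have "c * e = integral\<^sup>L P (\<lambda>x. c * g x)" unfolding g(2) by (rule integral_mult_right_zero[symmetric])
    moreover have "c * w \<pi> = Iprod n (\<lambda>x. c * g x) \<pi>" if "\<pi> \<in> PBaire" for \<pi>
      using g(3) that by (simp add: Iprod_def)
    ultimately show "(\<lambda>x. c * w x, c * e) \<in> R"
      using R_I[of "\<lambda>x. c * g x" "\<lambda>x. c * w x"] by (simp only:)
  next
    fix w e c assume w: "(w, e) \<in> R" and le: "\<And>\<pi>. \<pi> \<in> PBaire \<Longrightarrow> w \<pi> \<le> c"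
    obtain g where g: "ok g" "e = integral\<^sup>L P g" "\<forall>\<pi>\<in>PBaire. w \<pi> = Iprod n g \<pi>"
      using R_E[OF w] by blast
    obtain B where B: "g \<in> borel_measurable (prodS n Baire)" "\<And>x. \<bar>g x\<bar> \<le> B"
      using g(1) unfolding ok_def by blast
    have "Iprod n g \<pi> \<le> c" if "\<pi> \<in> PBaire" for \<pi> using g(3) le[OF that] that by simp
    then show "e \<le> c" unfolding g(2) by (rule normT_imp_integral_le[OF P norm B])
  next
    fix w e assume w: "(w, e) \<in> R"
    obtain g where g: "ok g" "\<forall>\<pi>\<in>PBaire. w \<pi> = Iprod n g \<pi>" using R_E[OF w] by blast
    obtain B where B: "\<And>x. \<bar>g x\<bar> \<le> B" using g(1) unfolding ok_def by blast
    show "w \<in> bounded_functions PBaire"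
    proof (rule bounded_functionsI)
      show "\<bar>w \<pi>\<bar> \<le> B" if \<pi>: "\<pi> \<in> PBaire" for \<pi>
        using g(2) \<pi> abs_integral_le_bound[OF prob_space_PiM_PBaire[OF \<pi>] B, of n]
        by (simp add: Iprod_def)
    qed
  qed
  then obtain L where L: "linear_functional_on (bounded_functions PBaire) L"
    and L_le': "\<forall>f\<in>bounded_functions PBaire. \<forall>c. (\<forall>x\<in>PBaire. f x \<le> c) \<longrightarrow> L f \<le> c"
    and L_eq': "\<forall>(w, e)\<in>R. L w = e"
    by (elim exE conjE)
  have L_le: "L f \<le> c" if "f \<in> bounded_functions PBaire" "\<And>x. x \<in> PBaire \<Longrightarrow> f x \<le> c" for f c
    using bspec[OF L_le' that(1)] that(2) by simp
  have L_eq: "L w = e" if "(w, e) \<in> R" for w e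
    using bspec[OF L_eq' that] by simp
  \<comment> \<open>Prescribed values on product functions. With test functions as factors, the
    argument of \<open>L\<close> lies in \<open>weak_test_functions\<close>, so these values will be
    integrals against \<open>\<nu>\<close>.\<close>
  have L_prod: "L (\<lambda>\<pi>. \<Prod>i<n. integral\<^sup>L \<pi> (f i)) = (\<integral>x. (\<Prod>i<n. f i (x i)) \<partial>P)"
    if f: "\<And>i. i < n \<Longrightarrow> f i \<in> borel_measurable Baire" "\<And>i x. \<bar>f i x\<bar> \<le> 1" for f
  proof (intro L_eq R_I)
    show "ok (\<lambda>x. \<Prod>i<n. f i (x i))"
      using f by (intro okI[of _ 1] borel_measurable_prod_coordinates) (auto simp: abs_prod intro!: prod_le_1)
    show "(\<Prod>i<n. integral\<^sup>L \<pi> (f i)) = Iprod n (\<lambda>x. \<Prod>i<n. f i (x i)) \<pi>" if "\<pi> \<in> PBaire" for \<pi>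
      using f that by (intro Iprod_prod_coordinates[symmetric, of _ _ _ "\<lambda>_. 1"])
  qed
  have tight': "\<exists>K. compact K \<and> K \<in> sets Baire \<and> L (\<lambda>\<pi>. measure \<pi> (- K)) \<le> e" if e: "0 < e" for e
  proof -
    obtain K where K: "compact K" "K \<in> sets Baire" "(\<integral>x. indicator (- K) (x 0) \<partial>P) \<le> e"
      using tight[OF e] by blast
    have K': "- K \<in> sets Baire" using sets.compl_sets[OF K(2)] by (simp add: Compl_eq_Diff_UNIV)
    define g where "g x = (indicator (- K) (x 0) :: real)" for x :: "nat \<Rightarrow> 'a"
    \<comment> \<open>The tail is written as a product function with one nontrivial factor, at index
      0, which exists as \<open>n > 0\<close>. All other factors integrate to 1, so
      \<open>Iprod\<close> of the product is \<open>\<pi>(-K)\<close>.\<close>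
    define f :: "nat \<Rightarrow> 'a \<Rightarrow> real" where "f i = (if i = 0 then indicator (- K) else (\<lambda>_. 1))" for i
    have f: "f i \<in> borel_measurable Baire" "\<bar>f i x\<bar> \<le> 1" for i x
      using K' by (auto simp: f_def indicator_def)
    have g_prod: "g = (\<lambda>x. \<Prod>i<n. f i (x i))"
    proof
      fix x :: "nat \<Rightarrow> 'a"
      have "(\<Prod>i<n. f i (x i)) = (\<Prod>i<n. if i = 0 then indicator (- K) (x 0) else 1)"
        by (intro prod.cong) (auto simp: f_def)
      then show "g x = (\<Prod>i<n. f i (x i))" using n by (simp add: g_def)
    qed
    have "measure \<pi> (- K) = Iprod n g \<pi>" if \<pi>: "\<pi> \<in> PBaire" for \<pi>
    proof -
      have "Iprod n g \<pi> = (\<Prod>i<n. integral\<^sup>L \<pi> (f i))"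
        unfolding g_prod using f \<pi> by (intro Iprod_prod_coordinates[of _ _ _ "\<lambda>_. 1"])
      also have "\<dots> = (\<Prod>i<n. if i = 0 then measure \<pi> (- K) else 1)"
        using \<pi> prob_space.prob_space[of \<pi>] by (intro prod.cong) (auto simp: f_def PBaire_iff PBaire_space)
      also have "\<dots> = measure \<pi> (- K)" using n by simp
      finally show ?thesis ..
    qed
    moreover have "ok g"
      unfolding g_prod using f
      by (intro okI[of _ 1] borel_measurable_prod_coordinates) (auto simp: abs_prod intro!: prod_le_1)
    ultimately have "L (\<lambda>\<pi>. measure \<pi> (- K)) = integral\<^sup>L P g" by (intro L_eq R_I)
    then show ?thesis using K unfolding g_def by (intro exI[of _ K]) auto
  qed
  have "\<exists>\<nu>. prob_space \<nu> \<and> sets \<nu> = sets (prob_algebra (Baire :: 'a measure)) \<and>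
    (\<forall>\<Phi>\<in>weak_test_functions. L \<Phi> = integral\<^sup>L \<nu> \<Phi>)"
    using L
  proof (rule weak_representing_measure)
    show "L \<Phi> \<le> c" if "\<Phi> \<in> bounded_functions PBaire" "\<And>\<pi>. \<pi> \<in> PBaire \<Longrightarrow> \<Phi> \<pi> \<le> c" for \<Phi> c
      using that by (rule L_le)
    show "\<exists>K. compact K \<and> K \<in> sets Baire \<and> L (\<lambda>\<pi>. measure \<pi> (- K)) \<le> e" if "0 < e" for e
      using that by (rule tight')
  qed
  then obtain \<nu> where \<nu>: "prob_space \<nu>" "sets \<nu> = sets (prob_algebra (Baire :: 'a measure))"
    and L_\<nu>: "\<forall>\<Phi>\<in>weak_test_functions. L \<Phi> = integral\<^sup>L \<nu> \<Phi>"
    by (elim exE conjE)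
  have "P = mixture \<nu> n"
  proof (rule prodS_eqI[OF P prob_space_mixture[OF \<nu>] sets_mixture[OF \<nu>]])
    fix f :: "nat \<Rightarrow> 'a \<Rightarrow> real" assume f: "\<And>i. f i \<in> test_functions" "\<And>i x. \<bar>f i x\<bar> \<le> 1"
    have fB: "f i \<in> borel_measurable Baire" for i by (rule test_functionsD(1)[OF f(1)])
    have "(\<integral>x. (\<Prod>i<n. f i (x i)) \<partial>P) = L (\<lambda>\<pi>. \<Prod>i<n. integral\<^sup>L \<pi> (f i))"
      using fB f(2) by (rule L_prod[symmetric])
    also have "\<dots> = (\<integral>\<pi>. (\<Prod>i<n. integral\<^sup>L \<pi> (f i)) \<partial>\<nu>)"
      by (intro bspec[OF L_\<nu>] weak_test_functions_prod weak_test_functions_integral f(1))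
    also have "\<dots> = (\<integral>\<pi>. Iprod n (\<lambda>x. \<Prod>i<n. f i (x i)) \<pi> \<partial>\<nu>)"
      using fB f(2) by (intro Bochner_Integration.integral_cong refl Iprod_prod_coordinates[symmetric, of _ _ _ "\<lambda>_. 1"])
        (auto simp: space_mixing[OF \<nu>])
    also have "\<dots> = (\<integral>x. (\<Prod>i<n. f i (x i)) \<partial>mixture \<nu> n)"
      using fB f(2) by (intro integral_mixture[OF \<nu>, symmetric, of _ _ 1] borel_measurable_prod_coordinates)
        (auto simp: abs_prod intro!: prod_le_1)
    finally show "(\<integral>x. (\<Prod>i<n. f i (x i)) \<partial>P) = (\<integral>x. (\<Prod>i<n. f i (x i)) \<partial>mixture \<nu> n)" .
  qed
  from \<nu> this show thesis by (rule that)
qed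

theorem theorem4:
  fixes M :: "'b measure" and X :: "'b \<Rightarrow> nat \<Rightarrow> 'a::t2_space" and n :: nat
  assumes "locally_compact_space (euclidean :: 'a topology)"
    and "n > 0"
    and "prob_space M"
    and "X \<in> measurable M (prodS n (Baire :: 'a measure))"
    and "exchangeable_law n (distr M (prodS n Baire) X)"
    and "outer_regular (distr M (Baire :: 'a measure) (\<lambda>\<omega>. X \<omega> 0))"
    and "tight_measure (distr M (Baire :: 'a measure) (\<lambda>\<omega>. X \<omega> 0))"
  shows "((\<forall>N\<ge>n. extendible_law n N (distr M (prodS n Baire) X))
            \<longleftrightarrow> normT n (distr M (prodS n Baire) X) = 1)
       \<and> (normT n (distr M (prodS n Baire) X) = 1
            \<longleftrightarrow> (\<exists>\<nu>. prob_space \<nu> \<and> sets \<nu> = sets (prob_algebra (Baire :: 'a measure)) \<and>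
                  (\<forall>A\<in>sets (prodS n (Baire :: 'a measure)).
                     measure M (X -` A \<inter> space M)
                       = (\<integral>\<pi>. measure (PiM {..<n} (\<lambda>_. \<pi>)) A \<partial>\<nu>))))"
proof -
  interpret M: prob_space M by fact
  note X = \<open>X \<in> measurable M (prodS n Baire)\<close>
  define P where "P = distr M (prodS n (Baire :: 'a measure)) X"
  have P: "prob_space P" "sets P = sets (prodS n (Baire :: 'a measure))"
    unfolding P_def using X by (simp_all add: M.prob_space_distr)
  have measure_P: "measure P A = measure M (X -` A \<inter> space M)" if "A \<in> sets (prodS n Baire)" for A
    unfolding P_def using X that by (rule measure_distr)
  have coord: "(\<lambda>x. x 0) \<in> measurable (prodS n (Baire :: 'a measure)) Baire"
    unfolding prodS_def using \<open>n > 0\<close> by (intro measurable_component_singleton) simp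
  \<comment> \<open>Coordinates are numbered from 0, so \<open>X \<omega> 0\<close> is
    \<open>X_1\<close>. The tail of its law is rewritten as an integral over the joint law, the form
    in which \<open>L\<close> can evaluate it.\<close>
  have tight: "\<exists>K. compact K \<and> K \<in> sets (Baire :: 'a measure) \<and> (\<integral>x. indicator (- K) (x 0) \<partial>P) \<le> e"
    if "0 < e" for e :: real
  proof -
    let ?P0 = "distr M (Baire :: 'a measure) (\<lambda>\<omega>. X \<omega> 0)"
    have X0: "(\<lambda>\<omega>. X \<omega> 0) \<in> measurable M (Baire :: 'a measure)" by (rule measurable_compose[OF X coord])
    interpret P0: prob_space ?P0 by (rule M.prob_space_distr[OF X0])
    obtain K where K: "compact K" "K \<in> sets (Baire :: 'a measure)" "measure ?P0 K \<ge> 1 - e"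
      using \<open>tight_measure ?P0\<close> \<open>0 < e\<close> unfolding tight_measure_def by (metis sets_distr)
    have K': "- K \<in> sets (Baire :: 'a measure)" using sets.compl_sets[OF K(2)] by (simp add: Compl_eq_Diff_UNIV)
    have "(\<integral>x. indicator (- K) (x 0) \<partial>P) = (\<integral>\<omega>. (indicator (- K) (X \<omega> 0) :: real) \<partial>M)"
      unfolding P_def
      by (rule integral_distr[OF X measurable_compose[OF coord borel_measurable_indicator[OF K']]])
    also have "\<dots> = (\<integral>x. indicator (- K) x \<partial>?P0)"
      by (rule integral_distr[OF X0 borel_measurable_indicator[OF K'], symmetric])
    also have "\<dots> = measure ?P0 (- K)" by simp
    also have "\<dots> = 1 - measure ?P0 K"
      using P0.prob_compl[of K] K(2) by (simp add: Compl_eq_Diff_UNIV)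
    finally show ?thesis using K by (intro exI[of _ K]) auto
  qed
  have mixture_iff: "(\<forall>A\<in>sets (prodS n (Baire :: 'a measure)). measure M (X -` A \<inter> space M) =
      (\<integral>\<pi>. measure (PiM {..<n} (\<lambda>_. \<pi>)) A \<partial>\<nu>)) \<longleftrightarrow> P = mixture \<nu> n"
    if \<nu>: "prob_space \<nu>" "sets \<nu> = sets (prob_algebra (Baire :: 'a measure))" for \<nu>
  proof
    assume *: "\<forall>A\<in>sets (prodS n (Baire :: 'a measure)). measure M (X -` A \<inter> space M) =
      (\<integral>\<pi>. measure (PiM {..<n} (\<lambda>_. \<pi>)) A \<partial>\<nu>)"
    show "P = mixture \<nu> n"
    proof (rule measure_eqI)
      show "sets P = sets (mixture \<nu> n)" using P(2) sets_mixture[OF \<nu>] by simp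
      show "emeasure P A = emeasure (mixture \<nu> n) A" if "A \<in> sets P" for A
        using that * measure_P measure_mixture[OF \<nu>, of A n] P prob_space_mixture[OF \<nu>, of n]
        by (simp add: prob_space_def finite_measure.emeasure_eq_measure)
    qed
  next
    assume "P = mixture \<nu> n"
    then show "\<forall>A\<in>sets (prodS n (Baire :: 'a measure)). measure M (X -` A \<inter> space M) =
      (\<integral>\<pi>. measure (PiM {..<n} (\<lambda>_. \<pi>)) A \<partial>\<nu>)"
      using measure_P measure_mixture[OF \<nu>] by metis
  qed
  let ?mixed = "\<exists>\<nu>. prob_space \<nu> \<and> sets \<nu> = sets (prob_algebra (Baire :: 'a measure)) \<and> P = mixture \<nu> n"
  have "normT n P = 1" if "\<forall>N\<ge>n. extendible_law n N P"
    using that by (intro extendible_imp_normT[OF P(1)]) blast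
  moreover have ?mixed if norm: "normT n P = 1"
  proof -
    obtain \<nu> where "prob_space \<nu>" "sets \<nu> = sets (prob_algebra (Baire :: 'a measure))" "P = mixture \<nu> n"
    proof (rule normT_imp_mixture[OF P \<open>n > 0\<close> _ norm])
      show "\<exists>K. compact K \<and> K \<in> sets (Baire :: 'a measure) \<and> (\<integral>x. indicator (- K) (x 0) \<partial>P) \<le> e"
        if "0 < e" for e :: real
        using that by (rule tight)
    qed
    then show ?thesis by (intro exI conjI)
  qed
  \<comment> \<open>The mixture representation yields both other conditions directly, which closes
    the cycle of implications.\<close>
  moreover have "(\<forall>N\<ge>n. extendible_law n N P) \<and> normT n P = 1" if mixed: ?mixed
  proof -
    obtain \<nu> where \<nu>: "prob_space \<nu>" "sets \<nu> = sets (prob_algebra (Baire :: 'a measure))" "P = mixture \<nu> n"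
      using mixed by (elim exE conjE)
    show ?thesis
      unfolding \<nu>(3) using extendible_mixture[OF \<nu>(1,2)] mixture_imp_normT[OF \<nu>(1,2)] by simp
  qed
  ultimately have main: "((\<forall>N\<ge>n. extendible_law n N P) \<longleftrightarrow> normT n P = 1) \<and> (normT n P = 1 \<longleftrightarrow> ?mixed)" by argo
  have mixed_iff: "(\<exists>\<nu>. prob_space \<nu> \<and> sets \<nu> = sets (prob_algebra (Baire :: 'a measure)) \<and>
      (\<forall>A\<in>sets (prodS n (Baire :: 'a measure)). measure M (X -` A \<inter> space M) =
        (\<integral>\<pi>. measure (PiM {..<n} (\<lambda>_. \<pi>)) A \<partial>\<nu>))) \<longleftrightarrow> ?mixed"
    by (rule ex_cong1) (intro conj_cong refl mixture_iff)
  show ?thesis unfolding P_def[symmetric] mixed_iff by (rule main)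
qed

end
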